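(* Consider any $\Delta \in (0,1)$, $M>5 l_f L_g$, integer $\tau>0$, and any sufficiently small $\epsilon >0$. Suppose the solver satisfies the solver assumption, the components $g_\xi$ satisfy assumptions (V) and (UL) of the context, $\inf_x \Phi(x) > -\infty$, the algorithm uses the estimator $\mathtt{estimator}_1$ of the context, and $\boldsymbol{\tau}$ is restricted to the form $\tau_0= \cdots= \tau_{K-1} = \tau$. There are constants $C_{\Sigma}, C_A, C_B, C_a, C_b$ (not depending on $\epsilon,\tau,\Delta$) such that, setting $K = \lceil \frac{C_{\Sigma} \epsilon^{-1}}{\tau} \rceil$, $A = \lceil C_A \epsilon^{-2} \log ( \frac{4(m+ 1) K \tau}{\Delta} ) \rceil$, $B = \lceil C_B \epsilon^{-1} \log ( \frac{4(m+ n) K \tau}{\Delta} ) \rceil$, $a = \lceil C_a \tau^2 \epsilon^{-1} \log ( \frac{4(m+ 1) K \tau}{\Delta} ) \rceil$, $b = \lceil C_b \tau^2 \log ( \frac{4(m+ n) K \tau}{\Delta} ) \rceil$, $\overline{\delta} = \Delta/ (2K\tau)$, $\overline{\epsilon} = \epsilon/(5\cdot 30M)$, with probability at least $1-\Delta$: (i) the iterates of the algorithm satisfy $$\frac{1}{K \tau} \sum_{k=0}^{K-1} \sum_{i=0}^{\tau -1} \| \mathcal{G}_M(x_i^k) \|_2 ^2 \le \epsilon;$$ (ii) provided $\tau = O(\epsilon^{-1})$, the oracle complexities for evaluations $g_\xi(\cdot)$ and Jacobians $g'_\xi(\cdot)$ of the inner components are respectively at most $$\widetilde{\Theta} \left(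 (\epsilon^{-3} \tau^{-1} + \epsilon^{-2} \tau^2) \log(1/\Delta) \right)\quad\text{and}\quad \widetilde{\Theta} \left( (\epsilon^{-2} \tau^{-1} + \epsilon^{-1} \tau^2) \log(1/\Delta) \right).$$
   Context: Problem. $f:\mathbb{R}^m\to\mathbb{R}$ is convex and $l_f$-Lipschitz; $g:\mathbb{R}^n\to\mathbb{R}^m$ is differentiable and $l_g$-Lipschitz, with $\|g'(x)-g'(y)\|_{\mathrm{op}}\le L_g\|x-y\|_2$ for all $x,y$ ($\|\cdot\|_{\mathrm{op}}$ is the spectral norm); $h:\mathbb{R}^n\to\mathbb{R}\cup\{+\infty\}$ is closed, convex and proper; $l_f,L_g>0$. $\Phi(x)=f(g(x))+h(x)$. Moreover $g(x)=\mathbb{E}_{\xi\sim D}[g_\xi(x)]$ and $g'(x)=\mathbb{E}_{\xi\sim D}[g'_\xi(x)]$ for differentiable components $g_\xi$. Stationarity measure. $\mathcal{G}_M(x)=M(x-x_+)$, $x_+=\operatorname{argmin}_{y}\{f(g(x)+g'(x)(y-x))+h(y)+\frac{M}{2}\|y-x\|_2^2\}$. Assumption (V): there are constants $\sigma_g,\sigma_{g'}$ with $\|g_\xi(x)-g(x)\|_2\le\sigma_g$ and $\|g'_\xi(x)-g'(x)\|_{\mathrm{op}}\le\sigma_{g'}$ for all $\xi\in\mathrm{supp}(D)$, $x\in\mathbb{R}^n$. Assumption (UL): there are constants $\widehat l_g,\widehat L_g$ with $\|g_\xi(x)-g_\xi(y)\|_2\le\widehat l_g\|x-y\|_2$ and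 $\|g'_\xi(x)-g'_\xi(y)\|_{\mathrm{op}}\le\widehat L_g\|x-y\|_2$ for all $\xi\in\mathrm{supp}(D)$, $x,y\in\mathbb{R}^n$. Algorithm. Inputs: $x_0^0\in\mathbb{R}^n$, $M>0$, $K\in\mathbb{N}_+$, $\boldsymbol{\tau}=(\tau_0,\dots,\tau_{K-1})\in\mathbb{N}_+^K$, an estimator, a solver, tolerances $\overline{\epsilon},\overline{\delta}>0$. For $k=0,\dots,K-1$: for $i=0,\dots,\tau_k-1$, (1) compute estimates $(\widetilde g_i^k,\widetilde J_i^k)$ of $g(x_i^k),g'(x_i^k)$ by the estimator; (2) with $s_i^k(x)=f(\widetilde g_i^k+\widetilde J_i^k(x-x_i^k))+h(x)+\frac{M}{2}\|x-x_i^k\|_2^2$, set $x_{i+1}^k=\mathtt{solver}(s_i^k,\overline{\epsilon},\overline{\delta})$. After the inner loop set $x_0^{k+1}=x_{\tau_k}^k$. $\mathtt{estimator}_1$, with parameters (batch sizes) $\theta=(A,B,a,b)\in\mathbb{N}_+^4$: at iteration $(k,i)$, draw batches $\mathcal{A}_i^k,\mathcal{B}_i^k$ of i.i.d. samples from $D$, independent of the past, of sizes $A,B$ if $i=0$ and $a,b$ if $i>0$. Set $\widetilde g_0^k=\frac1A\sum_{\xi\in\mathcal{A}_0^k}g_\xi(x_0^k)$, $\widetilde J_0^k=\frac1B\sum_{\xi\in\mathcal{B}_0^k}g'_\xi(x_0^k)$, and for $i>0$, $\widetilde g_i^k=\frac1a\sum_{\xi\in\mathcal{A}_i^k}(g_\xi(x_i^k)-g_\xi(x_0^k))+\widetilde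 g_0^k$, $\widetilde J_i^k=\frac1b\sum_{\xi\in\mathcal{B}_i^k}(g'_\xi(x_i^k)-g'_\xi(x_0^k))+\widetilde J_0^k$. Solver assumption. For $\overline{\epsilon},\overline{\delta}>0$ and the problem $\min_x s(x)$, with probability at least $1-\overline{\delta}$, $\mathtt{solver}(s,\overline{\epsilon},\overline{\delta})$ returns $x_{\mathrm{sol}}$ with $s(x_{\mathrm{sol}})\le\inf_x s(x)+\overline{\epsilon}$; this applies to each subproblem $s=s_i^k$ generated by the algorithm. Conventions. The oracle complexity for evaluations (Jacobians) is the total number of evaluations of $g_\xi(\cdot)$ (of $g'_\xi(\cdot)$) made by the algorithm. $O,\Theta$ are with respect to $\epsilon\to0$ ($\tau$ may depend on $\epsilon$); $\widetilde\Theta$ omits multiplicative logarithmic terms in $\epsilon$; ``at most $\widetilde\Theta(\cdot)$'' means bounded above by a quantity of that order. The constants $C_\Sigma,C_A,C_B,C_a,C_b$ may depend on $M$ and the fixed problem data. *)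

theory Defs
  imports "HOL-Probability.Probability" "HOL-Library.Landau_Symbols"
begin

section \<open>Extended-valued convex functions and the composite problem\<close>

definition ereal_epigraph :: "('a \<Rightarrow> ereal) \<Rightarrow> ('a \<times> real) set" where
  "ereal_epigraph h = {(x, r). h x \<le> ereal r}"

definition closed_convex_proper :: "('a::real_normed_vector \<Rightarrow> ereal) \<Rightarrow> bool" where
  "closed_convex_proper h \<longleftrightarrow>
     closed (ereal_epigraph h) \<and> convex (ereal_epigraph h) \<and>
     (\<forall>x. h x \<noteq> -\<infinity>) \<and> (\<exists>x. h x \<noteq> \<infinity>)"

text \<open>The norm on \<open>real ^ 'n ^ 'm\<close> is the Frobenius norm, so the spectral norm is
  introduced separately.\<close>

definition spectral_norm :: "real ^ 'n ^ 'm \<Rightarrow> real" where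
  "spectral_norm A = onorm (\<lambda>v. A *v v)"

locale composite_problem =
  fixes f :: "real ^ 'm \<Rightarrow> real"
    and g :: "real ^ 'n \<Rightarrow> real ^ 'm"
    and g' :: "real ^ 'n \<Rightarrow> real ^ 'n ^ 'm"
    and h :: "real ^ 'n \<Rightarrow> ereal"
    and l_f l_g L_g :: real
  assumes f_convex: "convex_on UNIV f"
    and f_lipschitz: "l_f-lipschitz_on UNIV f"
    and g_derivative: "\<And>x. (g has_derivative (\<lambda>v. g' x *v v)) (at x)"
    and g_lipschitz: "l_g-lipschitz_on UNIV g"
    and g'_lipschitz: "\<And>x y. spectral_norm (g' x - g' y) \<le> L_g * norm (x - y)"
    and h_closed_convex_proper: "closed_convex_proper h"
    and l_f_pos: "0 < l_f"
    and L_g_pos: "0 < L_g"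

definition Phi ::
  "(real ^ 'm \<Rightarrow> real) \<Rightarrow> (real ^ 'n \<Rightarrow> real ^ 'm) \<Rightarrow> (real ^ 'n \<Rightarrow> ereal) \<Rightarrow> real ^ 'n \<Rightarrow> ereal" where
  "Phi f g h x = ereal (f (g x)) + h x"

text \<open>The prox-linear model at \<open>x\<close> built from a value \<open>c\<close> and a Jacobian \<open>J\<close>. With exact
  \<open>c = g x\<close>, \<open>J = g' x\<close> it defines the stationarity measure; with estimates it is the
  subproblem solved by the algorithm.\<close>

definition prox_linear_model ::
  "(real ^ 'm \<Rightarrow> real) \<Rightarrow> (real ^ 'n \<Rightarrow> ereal) \<Rightarrow> real \<Rightarrow>
   real ^ 'm \<Rightarrow> real ^ 'n ^ 'm \<Rightarrow> real ^ 'n \<Rightarrow> real ^ 'n \<Rightarrow> ereal" where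
  "prox_linear_model f h M c J x y =
     ereal (f (c + J *v (y - x))) + h y + ereal (M / 2 * (norm (y - x))\<^sup>2)"

definition grad_map ::
  "(real ^ 'm \<Rightarrow> real) \<Rightarrow> (real ^ 'n \<Rightarrow> real ^ 'm) \<Rightarrow> (real ^ 'n \<Rightarrow> real ^ 'n ^ 'm) \<Rightarrow>
   (real ^ 'n \<Rightarrow> ereal) \<Rightarrow> real \<Rightarrow> real ^ 'n \<Rightarrow> real ^ 'n" where
  "grad_map f g g' h M x =
     M *\<^sub>R (x - (ARG_MIN (prox_linear_model f h M (g x) (g' x) x) y. True))"


section \<open>Stochastic components\<close>

definition supp :: "'s::topological_space measure \<Rightarrow> 's set" where
  "supp D = {\<xi>. \<forall>U. open U \<and> \<xi> \<in> U \<longrightarrow> 0 < emeasure D U}"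

text \<open>\<open>D\<close> is a Borel probability measure; second countability makes \<open>supp D\<close> a set of
  full measure.\<close>

locale stochastic_components =
  fixes g :: "real ^ 'n \<Rightarrow> real ^ 'm"
    and g' :: "real ^ 'n \<Rightarrow> real ^ 'n ^ 'm"
    and D :: "'s::second_countable_topology measure"
    and gs :: "'s \<Rightarrow> real ^ 'n \<Rightarrow> real ^ 'm"
    and gs' :: "'s \<Rightarrow> real ^ 'n \<Rightarrow> real ^ 'n ^ 'm"
  assumes D_prob: "prob_space D"
    and D_borel: "sets D = sets borel"
    and gs_derivative:
      "\<And>\<xi> x. \<xi> \<in> supp D \<Longrightarrow> (gs \<xi> has_derivative (\<lambda>v. gs' \<xi> x *v v)) (at x)"
    and gs_integrable: "\<And>x. integrable D (\<lambda>\<xi>. gs \<xi> x)"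
    and gs_mean: "\<And>x. g x = (LINT \<xi>|D. gs \<xi> x)"
    and gs'_integrable: "\<And>x. integrable D (\<lambda>\<xi>. gs' \<xi> x)"
    and gs'_mean: "\<And>x. g' x = (LINT \<xi>|D. gs' \<xi> x)"

definition assumption_V where
  "assumption_V g g' D gs gs' \<sigma>_g \<sigma>_g' \<longleftrightarrow>
     (\<forall>\<xi>\<in>supp D. \<forall>x.
        norm (gs \<xi> x - g x) \<le> \<sigma>_g \<and> spectral_norm (gs' \<xi> x - g' x) \<le> \<sigma>_g')"

definition assumption_UL where
  "assumption_UL D gs gs' lh_g Lh_g \<longleftrightarrow>
     (\<forall>\<xi>\<in>supp D. \<forall>x y.
        norm (gs \<xi> x - gs \<xi> y) \<le> lh_g * norm (x - y) \<and>
        spectral_norm (gs' \<xi> x - gs' \<xi> y) \<le> Lh_g * norm (x - y))"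


section \<open>The algorithm\<close>

text \<open>\<open>Q\<close> contains an event of probability at least \<open>p\<close>; for measurable \<open>Q\<close> this says that
  the probability of \<open>Q\<close> is at least \<open>p\<close>.\<close>

definition holds_with_prob :: "'w measure \<Rightarrow> real \<Rightarrow> ('w \<Rightarrow> bool) \<Rightarrow> bool" where
  "holds_with_prob P p Q \<longleftrightarrow> (\<exists>E\<in>sets P. p \<le> measure P E \<and> (\<forall>\<omega>\<in>E. Q \<omega>))"

definition batch_mean :: "nat \<Rightarrow> (nat \<Rightarrow> 'v::real_vector) \<Rightarrow> 'v" where
  "batch_mean N v = (1 / real N) *\<^sub>R (\<Sum>j<N. v j)"

definition per_iter :: "'a \<Rightarrow> 'a \<Rightarrow> nat \<Rightarrow> 'a" where
  "per_iter u v i = (if i = 0 then u else v)"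

text \<open>The events determined before the batches of iteration \<open>(k, i)\<close> are drawn: those generated
  by all iterates up to \<open>X k i\<close> and by all samples of the earlier iterations.\<close>

definition past_events ::
  "'w measure \<Rightarrow> 's measure \<Rightarrow> (nat \<Rightarrow> nat) \<Rightarrow> (nat \<Rightarrow> nat) \<Rightarrow> (nat \<Rightarrow> nat) \<Rightarrow>
   (nat \<Rightarrow> nat \<Rightarrow> 'w \<Rightarrow> real ^ 'n) \<Rightarrow>
   (nat \<Rightarrow> nat \<Rightarrow> nat \<Rightarrow> 'w \<Rightarrow> 's) \<Rightarrow> (nat \<Rightarrow> nat \<Rightarrow> nat \<Rightarrow> 'w \<Rightarrow> 's) \<Rightarrow>
   nat \<Rightarrow> nat \<Rightarrow> 'w set set" where
  "past_events P D \<tau>s sizeA sizeB X \<xi>A \<xi>B k i = sigma_sets (space P)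
     ((\<Union>(k', i') \<in> {(k', i'). k' < k \<and> i' \<le> \<tau>s k' \<or> k' = k \<and> i' \<le> i}.
         sets (vimage_algebra (space P) (X k' i') borel)) \<union>
      (\<Union>(k', i') \<in> {(k', i'). k' < k \<and> i' < \<tau>s k' \<or> k' = k \<and> i' < i}.
         (\<Union>j<sizeA i'. sets (vimage_algebra (space P) (\<xi>A k' i' j) D)) \<union>
         (\<Union>j<sizeB i'. sets (vimage_algebra (space P) (\<xi>B k' i' j) D))))"

text \<open>A batch of \<open>N\<close> i.i.d. samples from \<open>D\<close>, jointly independent of the events in \<open>\<F>\<close>.\<close>

definition fresh_batch ::
  "'w measure \<Rightarrow> 's measure \<Rightarrow> 'w set set \<Rightarrow> nat \<Rightarrow> (nat \<Rightarrow> 'w \<Rightarrow> 's) \<Rightarrow> bool" where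
  "fresh_batch P D \<F> N \<xi> \<longleftrightarrow>
     (\<forall>j<N. \<xi> j \<in> measurable P D \<and> distr P D (\<xi> j) = D) \<and>
     prob_space.indep_vars P (\<lambda>_. D) \<xi> {..<N} \<and>
     prob_space.indep_set P \<F>
       (sets (vimage_algebra (space P) (\<lambda>\<omega>. \<lambda>j\<in>{..<N}. \<xi> j \<omega>) (PiM {..<N} (\<lambda>_. D))))"

text \<open>A run of the algorithm with the first estimator and parameters \<open>(A, B, a, b)\<close>, on an
  arbitrary probability space \<open>P\<close>. \<open>X k i\<close>, \<open>gt k i\<close>, \<open>Jt k i\<close> are the iterate and the two
  estimates, \<open>\<xi>A k i\<close> and \<open>\<xi>B k i\<close> the two batches of iteration \<open>(k, i)\<close>. The last argument
  of \<open>solver\<close> is its internal randomness, supplied afresh by \<open>seed k i\<close> in every call.\<close>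

locale algorithm_run = prob_space P
  for P :: "'w measure" +
  fixes f :: "real ^ 'm \<Rightarrow> real"
    and h :: "real ^ 'n \<Rightarrow> ereal"
    and D :: "'s::second_countable_topology measure"
    and gs :: "'s \<Rightarrow> real ^ 'n \<Rightarrow> real ^ 'm"
    and gs' :: "'s \<Rightarrow> real ^ 'n \<Rightarrow> real ^ 'n ^ 'm"
    and x_init :: "real ^ 'n"
    and M :: real
    and K :: nat
    and \<tau>s :: "nat \<Rightarrow> nat"
    and A B a b :: nat
    and solver :: "(real ^ 'n \<Rightarrow> ereal) \<Rightarrow> real \<Rightarrow> real \<Rightarrow> 'r \<Rightarrow> real ^ 'n"
    and eps_bar delta_bar :: real
    and seed :: "nat \<Rightarrow> nat \<Rightarrow> 'w \<Rightarrow> 'r"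
    and X :: "nat \<Rightarrow> nat \<Rightarrow> 'w \<Rightarrow> real ^ 'n"
    and gt :: "nat \<Rightarrow> nat \<Rightarrow> 'w \<Rightarrow> real ^ 'm"
    and Jt :: "nat \<Rightarrow> nat \<Rightarrow> 'w \<Rightarrow> real ^ 'n ^ 'm"
    and \<xi>A \<xi>B :: "nat \<Rightarrow> nat \<Rightarrow> nat \<Rightarrow> 'w \<Rightarrow> 's"
  assumes X_measurable: "\<And>k i. k < K \<Longrightarrow> i \<le> \<tau>s k \<Longrightarrow> X k i \<in> borel_measurable P"
    and X_init: "\<And>\<omega>. \<omega> \<in> space P \<Longrightarrow> X 0 0 \<omega> = x_init"
    and X_outer: "\<And>k \<omega>. k < K \<Longrightarrow> \<omega> \<in> space P \<Longrightarrow> X (Suc k) 0 \<omega> = X k (\<tau>s k) \<omega>"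
    and X_inner: "\<And>k i \<omega>. k < K \<Longrightarrow> i < \<tau>s k \<Longrightarrow> \<omega> \<in> space P \<Longrightarrow>
      X k (Suc i) \<omega> =
        solver (prox_linear_model f h M (gt k i \<omega>) (Jt k i \<omega>) (X k i \<omega>))
          eps_bar delta_bar (seed k i \<omega>)"
    and batch_A: "\<And>k i. k < K \<Longrightarrow> i < \<tau>s k \<Longrightarrow>
      fresh_batch P D (past_events P D \<tau>s (per_iter A a) (per_iter B b) X \<xi>A \<xi>B k i)
        (per_iter A a i) (\<xi>A k i)"
    and batch_B: "\<And>k i. k < K \<Longrightarrow> i < \<tau>s k \<Longrightarrow>
      fresh_batch P D (past_events P D \<tau>s (per_iter A a) (per_iter B b) X \<xi>A \<xi>B k i)
        (per_iter B b i) (\<xi>B k i)"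
    and gt_0: "\<And>k \<omega>. k < K \<Longrightarrow> \<omega> \<in> space P \<Longrightarrow>
      gt k 0 \<omega> = batch_mean A (\<lambda>j. gs (\<xi>A k 0 j \<omega>) (X k 0 \<omega>))"
    and gt_pos: "\<And>k i \<omega>. k < K \<Longrightarrow> 0 < i \<Longrightarrow> i < \<tau>s k \<Longrightarrow> \<omega> \<in> space P \<Longrightarrow>
      gt k i \<omega> =
        batch_mean a (\<lambda>j. gs (\<xi>A k i j \<omega>) (X k i \<omega>) - gs (\<xi>A k i j \<omega>) (X k 0 \<omega>)) + gt k 0 \<omega>"
    and Jt_0: "\<And>k \<omega>. k < K \<Longrightarrow> \<omega> \<in> space P \<Longrightarrow>
      Jt k 0 \<omega> = batch_mean B (\<lambda>j. gs' (\<xi>B k 0 j \<omega>) (X k 0 \<omega>))"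
    and Jt_pos: "\<And>k i \<omega>. k < K \<Longrightarrow> 0 < i \<Longrightarrow> i < \<tau>s k \<Longrightarrow> \<omega> \<in> space P \<Longrightarrow>
      Jt k i \<omega> =
        batch_mean b (\<lambda>j. gs' (\<xi>B k i j \<omega>) (X k i \<omega>) - gs' (\<xi>B k i j \<omega>) (X k 0 \<omega>)) + Jt k 0 \<omega>"

definition solver_assumption ::
  "'w measure \<Rightarrow> (real ^ 'm \<Rightarrow> real) \<Rightarrow> (real ^ 'n \<Rightarrow> ereal) \<Rightarrow> real \<Rightarrow> nat \<Rightarrow> (nat \<Rightarrow> nat) \<Rightarrow>
   ((real ^ 'n \<Rightarrow> ereal) \<Rightarrow> real \<Rightarrow> real \<Rightarrow> 'r \<Rightarrow> real ^ 'n) \<Rightarrow> real \<Rightarrow> real \<Rightarrow>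
   (nat \<Rightarrow> nat \<Rightarrow> 'w \<Rightarrow> 'r) \<Rightarrow> (nat \<Rightarrow> nat \<Rightarrow> 'w \<Rightarrow> real ^ 'n) \<Rightarrow>
   (nat \<Rightarrow> nat \<Rightarrow> 'w \<Rightarrow> real ^ 'm) \<Rightarrow> (nat \<Rightarrow> nat \<Rightarrow> 'w \<Rightarrow> real ^ 'n ^ 'm) \<Rightarrow> bool" where
  "solver_assumption P f h M K \<tau>s solver eps_bar delta_bar seed X gt Jt \<longleftrightarrow>
     (\<forall>k<K. \<forall>i<\<tau>s k. holds_with_prob P (1 - delta_bar) (\<lambda>\<omega>.
        let s = prox_linear_model f h M (gt k i \<omega>) (Jt k i \<omega>) (X k i \<omega>)
        in s (solver s eps_bar delta_bar (seed k i \<omega>)) \<le> (INF y. s y) + ereal eps_bar))"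


section \<open>Parameters and complexity\<close>

definition outer_iters :: "real \<Rightarrow> real \<Rightarrow> nat \<Rightarrow> nat" where
  "outer_iters C \<epsilon> \<tau> = nat \<lceil>C * (1 / \<epsilon>) / real \<tau>\<rceil>"

definition batch_size :: "real \<Rightarrow> nat \<Rightarrow> nat \<Rightarrow> nat \<Rightarrow> real \<Rightarrow> nat" where
  "batch_size c d K \<tau> \<Delta> = nat \<lceil>c * ln (4 * real d * real K * real \<tau> / \<Delta>)\<rceil>"

text \<open>Number of component evaluations with batch sizes \<open>N\<close> (for \<open>i = 0\<close>) and \<open>n\<close> (for
  \<open>i > 0\<close>): in the latter case every sampled component is evaluated at both \<open>X k i\<close> and
  \<open>X k 0\<close>.\<close>

definition oracle_calls :: "nat \<Rightarrow> (nat \<Rightarrow> nat) \<Rightarrow> nat \<Rightarrow> nat \<Rightarrow> nat" where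
  "oracle_calls K \<tau>s N n = (\<Sum>k<K. \<Sum>i<\<tau>s k. per_iter N (2 * n) i)"

text \<open>In the complexity bounds \<open>\<tau>\<close> and \<open>\<Delta>\<close> are functions of \<open>\<epsilon>\<close>, the latter bounded away from
  \<open>1\<close>; constant functions give the case of fixed parameters. This keeps the factor
  \<open>ln (1 / \<Delta>)\<close> meaningful, since it cannot be absorbed into a constant depending on \<open>\<Delta>\<close>. (As
  \<open>\<Delta>\<close> tends to \<open>1\<close> the factor vanishes while the number of evaluations does not.)\<close>

definition soft_theta :: "(real \<Rightarrow> real) \<Rightarrow> (real \<Rightarrow> real) set" where
  "soft_theta v = {w. \<exists>p::nat. w \<in> \<Theta>[at_right 0](\<lambda>\<epsilon>. v \<epsilon> * ln (1 / \<epsilon>) ^ p)}"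

definition at_most_soft_theta :: "(real \<Rightarrow> real) \<Rightarrow> (real \<Rightarrow> real) \<Rightarrow> bool" where
  "at_most_soft_theta u v \<longleftrightarrow> (\<exists>w \<in> soft_theta v. eventually (\<lambda>\<epsilon>. u \<epsilon> \<le> w \<epsilon>) (at_right 0))"

end

theory Submission
  imports Defs
begin

text \<open>The Lyapunov function is \<open>\<Phi>\<close> itself. Comparing the inexact minimiser of the perturbed
  prox-linear model with the exact minimiser of the true model shows that one step decreases
  \<open>\<Phi>\<close> by a multiple of the squared stationarity measure plus \<open>M / 5\<close> times the squared step length, up to
  the solver tolerance and the terms \<open>2 l_f e_g + 8 l_f\<^sup>2 e_J\<^sup>2 / M\<close> in the errors \<open>e_g\<close>, \<open>e_J\<close> of
  the two estimates. The estimates of an inner loop deviate by \<open>O(\<epsilon>)\<close>, \<open>O(\<surd>\<epsilon>)\<close> at its first point and,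
  by the Lipschitz bounds, by an additional \<open>O(\<surd>\<epsilon> / \<tau>)\<close>, \<open>O(1 / \<tau>)\<close> times the distance from that point, so the
  accumulated error is paid for by the squared step lengths. The deviations hold with high
  probability by Hoeffding's inequality in each coordinate; the dimension enters only the constants.\<close>

section \<open>Descent of the prox-linear step\<close>

text \<open>The two errors enter unevenly: a value error shifts the model by a constant, whereas a
  Jacobian error is multiplied by the step, so that Young's inequality can charge part of it to the
  prox term and leave only its square. Hence the value error must be of order
  \<open>\<epsilon>\<close> but the Jacobian error only of order sqrt \<open>\<epsilon>\<close>; as
  a batch of size N shrinks deviations like 1 / sqrt N, this dictates the orders of \<open>A\<close>
  and \<open>B\<close>. The factor \<open>\<tau>\<^sup>2\<close> in \<open>a\<close> and
  \<open>b\<close> pays for the drift: corrections refer to the first point of the loop, so their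
  errors do not pile up, but that point may be \<open>\<tau>\<close> steps away. The probabilistic
  obstacle is that the evaluation points are random and their distance has no a priori bound. Tails
  are therefore stated relative to the range \<open>c\<close> of the summands: the probability of
  exceeding \<open>t * c\<close> is bounded in terms of \<open>N\<close> and \<open>t\<close> alone,
  uniformly in the random point. A union bound over all iterations, with three failure events each
  (value, Jacobian, solver), then determines the logarithms in the batch sizes.\<close>

lemma norm_mult_le_spectral_norm: "norm (A *v v) \<le> spectral_norm A * norm v"
  unfolding spectral_norm_def
  by (rule onorm) (rule matrix_vector_mul_bounded_linear)

lemma spectral_norm_nonneg: "0 \<le> spectral_norm A"
  unfolding spectral_norm_def by (rule onorm_pos_le) (rule matrix_vector_mul_bounded_linear)

lemma component_le_spectral_norm: "\<bar>A $ i $ j\<bar> \<le> spectral_norm A"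
  unfolding spectral_norm_def by (rule matrix_component_le_onorm)

lemma spectral_norm_triangle: "spectral_norm (A + B) \<le> spectral_norm A + spectral_norm B"
  unfolding spectral_norm_def matrix_vector_mult_add_rdistrib
  by (rule onorm_triangle) (rule matrix_vector_mul_bounded_linear)+

lemma real_le_of_ereal_epigraph:
  assumes "closed_convex_proper h" "h y \<le> ereal r"
  obtains q where "h y = ereal q" "q \<le> r"
  using assms by (cases "h y") (auto simp: closed_convex_proper_def)

context composite_problem
begin

lemma f_diff_le: "\<bar>f u - f v\<bar> \<le> l_f * norm (u - v)"
  using lipschitz_onD[OF f_lipschitz, of u v] by (simp add: dist_norm)

text \<open>Mean value inequality on the segment, along which the derivative varies by at most
  \<open>L_g * norm (y - x)\<close>. Integrating would halve the constant; the margin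
  \<open>M > 5 * l_f * L_g\<close> absorbs the loss.\<close>

lemma linearization_error: "norm (g y - g x - g' x *v (y - x)) \<le> L_g * (norm (y - x))\<^sup>2"
proof -
  have "norm (g y - g x - g' x *v (y - x)) \<le> norm (y - x) * (L_g * norm (y - x))"
  proof (rule differentiable_bound_linearization[where S="closed_segment x y" and f'="\<lambda>z v. g' z *v v"])
    show "x + t *\<^sub>R (y - x) \<in> closed_segment x y" if "t \<in> {0..1}" for t
      using that by (auto simp: in_segment algebra_simps intro!: exI[of _ t])
    show "(g has_derivative (*v) (g' z)) (at z within closed_segment x y)" for z
      using g_derivative has_derivative_at_withinI by blast
    fix z assume z: "z \<in> closed_segment x y"
    have "onorm ((*v) (g' z) - (*v) (g' x)) = spectral_norm (g' z - g' x)"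
      unfolding spectral_norm_def
      by (rule arg_cong[where f=onorm]) (auto simp: matrix_vector_mult_diff_rdistrib)
    also have "\<dots> \<le> L_g * norm (z - x)" by (rule g'_lipschitz)
    also have "\<dots> \<le> L_g * norm (y - x)"
      using segment_bound1[OF z] L_g_pos by (auto intro!: mult_left_mono)
    finally show "onorm ((*v) (g' z) - (*v) (g' x)) \<le> L_g * norm (y - x)" .
  qed auto
  then show ?thesis by (simp add: power2_eq_square mult_ac)
qed

lemma f_linearization_error:
  "\<bar>f (g y) - f (g x + g' x *v (y - x))\<bar> \<le> l_f * L_g * (norm (y - x))\<^sup>2"
proof -
  have "\<bar>f (g y) - f (g x + g' x *v (y - x))\<bar> \<le> l_f * norm (g y - g x - g' x *v (y - x))"
    using f_diff_le[of "g y" "g x + g' x *v (y - x)"] by (simp add: algebra_simps)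
  also have "\<dots> \<le> l_f * (L_g * (norm (y - x))\<^sup>2)"
    using linearization_error l_f_pos by (intro mult_left_mono) auto
  finally show ?thesis by (simp add: mult_ac)
qed

lemma model_perturbation:
  assumes "norm (c - g x) \<le> eg" "spectral_norm (J - g' x) \<le> eJ"
  shows "\<bar>f (c + J *v v) - f (g x + g' x *v v)\<bar> \<le> l_f * (eg + eJ * norm v)"
proof -
  have "\<bar>f (c + J *v v) - f (g x + g' x *v v)\<bar> \<le> l_f * norm ((c + J *v v) - (g x + g' x *v v))"
    by (rule f_diff_le)
  also have "(c + J *v v) - (g x + g' x *v v) = (c - g x) + (J - g' x) *v v"
    by (simp add: matrix_vector_mult_diff_rdistrib)
  also have "norm \<dots> \<le> norm (c - g x) + spectral_norm (J - g' x) * norm v"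
    using norm_triangle_ineq norm_mult_le_spectral_norm by (meson add_left_mono order_trans)
  also have "\<dots> \<le> eg + eJ * norm v"
    using assms by (intro add_mono mult_right_mono) auto
  finally show ?thesis using l_f_pos by (simp add: mult_left_mono)
qed

end

section \<open>Existence and quadratic growth of the prox-linear minimiser\<close>

locale prox_linear = composite_problem f g g' h l_f l_g L_g
  for f :: "real ^ 'm \<Rightarrow> real"
    and g :: "real ^ 'n \<Rightarrow> real ^ 'm"
    and g' :: "real ^ 'n \<Rightarrow> real ^ 'n ^ 'm"
    and h :: "real ^ 'n \<Rightarrow> ereal"
    and l_f l_g L_g :: real +
  fixes M p :: real
  assumes M_large: "M > 5 * l_f * L_g"
    and Phi_ge: "\<And>y. ereal p \<le> Phi f g h y"
begin

lemma M_pos: "0 < M"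
proof -
  have "0 < l_f * L_g" using l_f_pos L_g_pos by simp
  then show ?thesis using M_large by linarith
qed

text \<open>The model without \<open>h\<close>. It is real-valued, so once \<open>h\<close> is known
  to be finite at a point the comparison of models is plain real arithmetic.\<close>

definition model_fin :: "real ^ 'n \<Rightarrow> real ^ 'n \<Rightarrow> real" where
  "model_fin x y = f (g x + g' x *v (y - x)) + M / 2 * (norm (y - x))\<^sup>2"

lemma prox_linear_model_eq:
  "h y = ereal q \<Longrightarrow> prox_linear_model f h M (g x) (g' x) x y = ereal (model_fin x y + q)"
  by (simp add: prox_linear_model_def model_fin_def)

lemma Phi_ge_real: "h y \<le> ereal q \<Longrightarrow> p \<le> f (g y) + q"
proof (erule real_le_of_ereal_epigraph[OF h_closed_convex_proper])
  fix q' assume "h y = ereal q'" "q' \<le> q"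
  then show ?thesis using Phi_ge[of y] by (simp add: Phi_def)
qed

text \<open>Since the prox term dominates the linearisation error, a lower bound on the objective
  makes the model coercive; no affine minorant of \<open>h\<close> is needed.\<close>

lemma model_coercive:
  assumes "h y \<le> ereal q"
  shows "p + 3 * M / 10 * (norm (y - x))\<^sup>2 \<le> model_fin x y + q"
proof -
  have "f (g y) - l_f * L_g * (norm (y - x))\<^sup>2 \<le> f (g x + g' x *v (y - x))"
    using f_linearization_error[of y x] by linarith
  \<comment> \<open>Of the prox term there remains
    \<open>M / 2 - M / 5 = 3 * M / 10\<close>.\<close>
  moreover have "l_f * L_g * (norm (y - x))\<^sup>2 \<le> M / 5 * (norm (y - x))\<^sup>2"
    using M_large by (intro mult_right_mono) auto
  ultimately show ?thesis using Phi_ge_real[OF assms] by (simp add: model_fin_def field_simps)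
qed

lemma continuous_on_model_fin: "continuous_on S (model_fin x)"
proof -
  have "continuous_on UNIV f" using lipschitz_on_continuous_on[OF f_lipschitz] .
  then have "continuous_on S (\<lambda>y. f (g x + g' x *v (y - x)))"
    by (rule continuous_on_compose2)
      (auto intro!: continuous_intros continuous_on_compose2[OF linear_continuous_on[OF matrix_vector_mul_bounded_linear]])
  then show ?thesis unfolding model_fin_def by (intro continuous_intros)
qed

text \<open>\<open>h\<close> is merely lower semicontinuous, so the minimum is taken over its closed
  epigraph, where the objective becomes the continuous function \<open>model_fin x y + q\<close>.
  The sublevel set through a point of the domain is compact, and a minimiser there projects to a
  minimiser of the model.\<close>

lemma model_has_minimizer:
  obtains y where "\<And>z. prox_linear_model f h M (g x) (g' x) x y \<le> prox_linear_model f h M (g x) (g' x) x z"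
proof -
  obtain y0 q0 where y0: "h y0 = ereal q0"
    using h_closed_convex_proper unfolding closed_convex_proper_def by (metis ereal_cases)
  define c where "c = model_fin x y0 + q0"
  define T where "T = ereal_epigraph h \<inter> {w. model_fin x (fst w) + snd w \<le> c}"
  define R where "R = sqrt ((c - p) / (3 * M / 10))"
  have cont: "continuous_on S (\<lambda>w. model_fin x (fst w) + snd w)" for S :: "((real ^ 'n) \<times> real) set"
    by (intro continuous_intros continuous_on_compose2[OF continuous_on_model_fin]) auto
  have "bounded (model_fin x ` cball x R)"
    by (intro compact_imp_bounded compact_continuous_image continuous_on_model_fin) simp
  then obtain C where C: "\<And>y. y \<in> cball x R \<Longrightarrow> \<bar>model_fin x y\<bar> \<le> C"
    unfolding bounded_iff real_norm_def by blast
  \<comment> \<open>Coercivity bounds the point. The height is bounded because its sum with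
    \<open>model_fin\<close> lies between \<open>p\<close> and \<open>c\<close>, while
    \<open>model_fin\<close> is at most \<open>C\<close> in absolute value on the ball.\<close>
  have T: "(y, q) \<in> T \<Longrightarrow> y \<in> cball x R \<and> q \<in> cball 0 (\<bar>c\<bar> + \<bar>p\<bar> + C)" for y q
  proof -
    assume "(y, q) \<in> T"
    then have *: "h y \<le> ereal q" "model_fin x y + q \<le> c" by (auto simp: T_def ereal_epigraph_def)
    have co: "p + 3 * M / 10 * (norm (y - x))\<^sup>2 \<le> model_fin x y + q" using model_coercive[OF *(1)] .
    then have "(norm (y - x))\<^sup>2 \<le> (c - p) / (3 * M / 10)"
      using *(2) M_pos by (simp add: field_simps)
    then have "norm (y - x) \<le> R" unfolding R_def by (simp add: real_le_rsqrt)
    then have y: "y \<in> cball x R" by (simp add: dist_norm norm_minus_commute)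
    have "0 \<le> 3 * M / 10 * (norm (y - x))\<^sup>2" using M_pos by simp
    then have "p \<le> model_fin x y + q" using co by linarith
    with C[OF y] *(2) y show ?thesis by auto
  qed
  then have "T \<subseteq> cball x R \<times> cball 0 (\<bar>c\<bar> + \<bar>p\<bar> + C)" by auto
  then have "bounded T" by (rule bounded_subset[rotated]) (intro bounded_Times bounded_cball)
  moreover have "closed T" unfolding T_def
    using h_closed_convex_proper
    by (intro closed_Int closed_Collect_le cont continuous_intros) (simp add: closed_convex_proper_def)
  ultimately have "compact T" by (simp add: compact_eq_bounded_closed)
  moreover have y0T: "(y0, q0) \<in> T" by (simp add: T_def y0 ereal_epigraph_def c_def)
  ultimately obtain w where w: "w \<in> T" "\<And>v. v \<in> T \<Longrightarrow> model_fin x (fst w) + snd w \<le> model_fin x (fst v) + snd v"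
    using continuous_attains_inf[of T, OF _ _ cont] by blast
  obtain q where q: "h (fst w) = ereal q" "q \<le> snd w"
    using real_le_of_ereal_epigraph[OF h_closed_convex_proper, of "fst w" "snd w"] w(1)
    by (auto simp: T_def ereal_epigraph_def case_prod_beta)
  show ?thesis
  proof (rule that[of "fst w"])
    fix z
    show "prox_linear_model f h M (g x) (g' x) x (fst w) \<le> prox_linear_model f h M (g x) (g' x) x z"
    proof (cases "h z")
      case (real r)
      have "model_fin x (fst w) + snd w \<le> model_fin x z + r"
      proof (cases "(z, r) \<in> T")
        case True
        then show ?thesis using w(2) by fastforce
      next
        case False
        then have "c < model_fin x z + r" using real by (auto simp: T_def ereal_epigraph_def)
        then show ?thesis using w(2)[OF y0T] by (simp add: c_def)
      qed
      then show ?thesis using q real by (simp add: prox_linear_model_eq)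
    next
      case PInf
      then show ?thesis by (simp add: prox_linear_model_def)
    next
      case MInf
      then show ?thesis using h_closed_convex_proper by (auto simp: closed_convex_proper_def)
    qed
  qed
qed

definition prox_point :: "real ^ 'n \<Rightarrow> real ^ 'n" where
  "prox_point x = (ARG_MIN (prox_linear_model f h M (g x) (g' x) x) y. True)"

lemma grad_map_eq: "grad_map f g g' h M x = M *\<^sub>R (x - prox_point x)"
  by (simp add: grad_map_def prox_point_def)

text \<open>\<open>ARG_MIN\<close> is a Hilbert choice; \<open>model_has_minimizer\<close> supplies
  the existence that makes the chosen point a minimiser.\<close>

lemma prox_point_minimizes:
  "prox_linear_model f h M (g x) (g' x) x (prox_point x) \<le> prox_linear_model f h M (g x) (g' x) x z"
proof -
  obtain y where "\<And>z. prox_linear_model f h M (g x) (g' x) x y \<le> prox_linear_model f h M (g x) (g' x) x z"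
    by (rule model_has_minimizer[of x]) blast
  then have "is_arg_min (prox_linear_model f h M (g x) (g' x) x) (\<lambda>_. True) y"
    by (auto simp: is_arg_min_def not_less)
  then have "is_arg_min (prox_linear_model f h M (g x) (g' x) x) (\<lambda>_. True) (prox_point x)"
    unfolding prox_point_def arg_min_def by (rule someI)
  then show ?thesis by (auto simp: is_arg_min_def not_less)
qed

text \<open>Strong convexity of the prox term, tested at the midpoint of the minimiser and
  \<open>y\<close>; this yields half of the sharp constant \<open>M / 2\<close>. Finiteness of
  \<open>h\<close> at the prox point comes from comparison with \<open>y\<close>, where the model is
  finite.\<close>

lemma prox_point_growth:
  assumes "h y = ereal q"
  obtains qp where "h (prox_point x) = ereal qp"
    "model_fin x (prox_point x) + qp + M / 4 * (norm (y - prox_point x))\<^sup>2 \<le> model_fin x y + q"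
proof -
  define xp where "xp = prox_point x"
  have min: "prox_linear_model f h M (g x) (g' x) x xp \<le> prox_linear_model f h M (g x) (g' x) x z" for z
    unfolding xp_def by (rule prox_point_minimizes)
  have "h xp \<noteq> \<infinity>" using min[of y] assms by (auto simp: prox_linear_model_def)
  moreover have "h xp \<noteq> -\<infinity>" using h_closed_convex_proper by (auto simp: closed_convex_proper_def)
  ultimately obtain qp where qp: "h xp = ereal qp" by (cases "h xp") auto
  define z where "z = (1/2) *\<^sub>R xp + (1/2) *\<^sub>R y"
  have "convex (ereal_epigraph h)" using h_closed_convex_proper by (simp add: closed_convex_proper_def)
  then have "(1/2) *\<^sub>R (xp, qp) + (1/2) *\<^sub>R (y, q) \<in> ereal_epigraph h"
    by (rule convexD) (auto simp: ereal_epigraph_def qp assms)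
  then have "h z \<le> ereal (qp / 2 + q / 2)" by (simp add: ereal_epigraph_def z_def)
  then obtain r where r: "h z = ereal r" "r \<le> qp / 2 + q / 2"
    by (rule real_le_of_ereal_epigraph[OF h_closed_convex_proper])
  have zx: "z - x = (1/2) *\<^sub>R ((xp - x) + (y - x))"
    by (simp add: z_def scaleR_add_right scaleR_diff_right vec_eq_iff field_simps)
  have "model_fin x xp + qp \<le> model_fin x z + r"
    using min[of z] by (simp add: prox_linear_model_eq qp r)
  moreover have "f (g x + g' x *v (z - x)) \<le> f (g x + g' x *v (xp - x)) / 2 + f (g x + g' x *v (y - x)) / 2"
  proof -
    have "g x + g' x *v (z - x) = (1/2) *\<^sub>R (g x + g' x *v (xp - x)) + (1/2) *\<^sub>R (g x + g' x *v (y - x))"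
    proof -
      have "g' x *v (z - x) = (1/2) *\<^sub>R (g' x *v (xp - x)) + (1/2) *\<^sub>R (g' x *v (y - x))"
        by (simp only: zx scaleR_add_right matrix_vector_right_distrib matrix_vector_mult_scaleR)
      then show ?thesis
        by (simp only: vec_eq_iff vector_add_component vector_scaleR_component) (simp add: field_simps)
    qed
    then show ?thesis
      using convex_onD[OF f_convex, of "1/2" "g x + g' x *v (xp - x)" "g x + g' x *v (y - x)"] by simp
  qed
  \<comment> \<open>Parallelogram identity; its negative term is the gain from strong
    convexity.\<close>
  moreover have "(norm (z - x))\<^sup>2 = (norm (xp - x))\<^sup>2 / 2 + (norm (y - x))\<^sup>2 / 2 - (norm (y - xp))\<^sup>2 / 4"
  proof -
    have "(norm ((1/2) *\<^sub>R (u + v)))\<^sup>2 = (norm u)\<^sup>2 / 2 + (norm v)\<^sup>2 / 2 - (norm (v - u))\<^sup>2 / 4" for u v :: "real ^ 'n"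
      unfolding power2_norm_eq_inner by (simp add: inner_simps inner_commute field_simps)
    from this[of "xp - x" "y - x"] show ?thesis by (simp add: zx)
  qed
  then have "M / 2 * (norm (z - x))\<^sup>2 =
      M / 2 * (norm (xp - x))\<^sup>2 / 2 + M / 2 * (norm (y - x))\<^sup>2 / 2 - M / 4 * (norm (y - xp))\<^sup>2 / 2"
    by (simp only:) (simp add: field_simps)
  ultimately have "model_fin x xp + qp + M / 4 * (norm (y - xp))\<^sup>2 \<le> model_fin x y + q"
    using r(2) unfolding model_fin_def by argo
  then show ?thesis using that qp unfolding xp_def by blast
qed

text \<open>A completed square. \<open>e\<close> will be a Jacobian error and \<open>r\<close> a
  step length; the weight \<open>M / 16\<close> is small enough for \<open>descent_step\<close> to
  spend it on both the actual and the exact step.\<close>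

lemma young: "l_f * (e * r) \<le> M / 16 * r\<^sup>2 + 4 * l_f\<^sup>2 * e\<^sup>2 / M"
proof -
  have "0 \<le> (M / 4 * r - 2 * l_f * e)\<^sup>2 / M" using M_pos by simp
  also have "\<dots> = M / 16 * r\<^sup>2 + 4 * l_f\<^sup>2 * e\<^sup>2 / M - l_f * (e * r)"
    using M_pos by (simp add: power2_eq_square field_simps)
  finally show ?thesis by simp
qed

text \<open>The reference point \<open>y\<close> will be the current iterate \<open>x\<close>, except at an initial point with
  \<open>h x = \<infinity>\<close>, where any point of the domain of \<open>h\<close> does.\<close>

lemma descent_step:
  assumes y: "h y = ereal q"
    and eg: "norm (c - g x) \<le> eg" and eJ: "spectral_norm (J - g' x) \<le> eJ"
    and sol: "\<And>z. prox_linear_model f h M c J x x' \<le> prox_linear_model f h M c J x z + ereal eb"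
  obtains q' where "h x' = ereal q'"
    "(norm (grad_map f g g' h M x))\<^sup>2 / (16 * M) + M / 5 * (norm (x' - x))\<^sup>2
      \<le> model_fin x y + q + M / 4 * (norm (y - x))\<^sup>2 - (f (g x') + q')
        + eb + 2 * l_f * eg + 8 * l_f\<^sup>2 / M * eJ\<^sup>2"
proof -
  define xp where "xp = prox_point x"
  obtain qp where qp: "h xp = ereal qp"
    "model_fin x xp + qp + M / 4 * (norm (y - xp))\<^sup>2 \<le> model_fin x y + q"
    using prox_point_growth[OF y] unfolding xp_def by metis
  have "h x' \<noteq> \<infinity>" using sol[of y] y by (auto simp: prox_linear_model_def)
  moreover have "h x' \<noteq> -\<infinity>" using h_closed_convex_proper by (auto simp: closed_convex_proper_def)
  ultimately obtain q' where q': "h x' = ereal q'" by (cases "h x'") auto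
  define r d where "r = norm (xp - x)" and "d = norm (x' - x)"
  have "prox_linear_model f h M c J x x' = ereal (f (c + J *v (x' - x)) + q' + M / 2 * d\<^sup>2)"
    "prox_linear_model f h M c J x xp = ereal (f (c + J *v (xp - x)) + qp + M / 2 * r\<^sup>2)"
    by (simp_all add: prox_linear_model_def q' qp r_def d_def)
  with sol[of xp] have "f (c + J *v (x' - x)) + q' + M / 2 * d\<^sup>2 \<le> f (c + J *v (xp - x)) + qp + M / 2 * r\<^sup>2 + eb"
    by simp
  moreover have "f (g x + g' x *v (x' - x)) \<le> f (c + J *v (x' - x)) + l_f * (eg + eJ * d)"
    "f (c + J *v (xp - x)) \<le> f (g x + g' x *v (xp - x)) + l_f * (eg + eJ * r)"
    using model_perturbation[OF eg eJ, of "x' - x"] model_perturbation[OF eg eJ, of "xp - x"]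
    by (auto simp: r_def d_def)
  moreover have "f (g x') \<le> f (g x + g' x *v (x' - x)) + M / 5 * d\<^sup>2"
  proof -
    have "f (g x') \<le> f (g x + g' x *v (x' - x)) + l_f * L_g * d\<^sup>2"
      using f_linearization_error[of x' x] by (simp add: d_def)
    moreover have "l_f * L_g * d\<^sup>2 \<le> M / 5 * d\<^sup>2"
      using M_large by (intro mult_right_mono) auto
    ultimately show ?thesis by linarith
  qed
  moreover have "l_f * (eg + eJ * d) \<le> l_f * eg + (M / 16 * d\<^sup>2 + 4 * l_f\<^sup>2 * eJ\<^sup>2 / M)"
    "l_f * (eg + eJ * r) \<le> l_f * eg + (M / 16 * r\<^sup>2 + 4 * l_f\<^sup>2 * eJ\<^sup>2 / M)"
    using young[of eJ d] young[of eJ r] by (auto simp: distrib_left)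
  \<comment> \<open>Transfers the growth around the exact minimiser from \<open>y\<close> to
    \<open>x\<close>; the price in \<open>norm (y - x)\<close> vanishes in the usual case
    \<open>y = x\<close>.\<close>
  moreover have "M / 8 * r\<^sup>2 \<le> M / 4 * (norm (y - x))\<^sup>2 + M / 4 * (norm (y - xp))\<^sup>2"
  proof -
    have "r \<le> norm (y - x) + norm (y - xp)"
      unfolding r_def using norm_triangle_ineq4[of "y - x" "y - xp"] by simp
    then have "r\<^sup>2 \<le> (norm (y - x) + norm (y - xp))\<^sup>2" by (intro power_mono) (auto simp: r_def)
    also have "\<dots> \<le> 2 * (norm (y - x))\<^sup>2 + 2 * (norm (y - xp))\<^sup>2"
      using sum_squares_bound[of "norm (y - x)" "norm (y - xp)"] by (simp add: power2_sum)
    finally have "M / 8 * r\<^sup>2 \<le> M / 8 * (2 * (norm (y - x))\<^sup>2 + 2 * (norm (y - xp))\<^sup>2)"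
      using M_pos by (intro mult_left_mono) auto
    then show ?thesis by (simp add: algebra_simps)
  qed
  moreover have "0 \<le> M * d\<^sup>2" using M_pos by simp
  moreover note qp(2)[unfolded model_fin_def r_def[symmetric]]
  \<comment> \<open>Balance: \<open>r\<^sup>2\<close> keeps \<open>M / 8 - M / 16 = M / 16\<close>,
    and \<open>d\<^sup>2\<close> keeps \<open>M / 2 - M / 5 - M / 16 = 19 * M / 80\<close>, which
    exceeds \<open>M / 5\<close>.\<close>
  ultimately have "M / 16 * r\<^sup>2 + M / 5 * d\<^sup>2
      \<le> model_fin x y + q + M / 4 * (norm (y - x))\<^sup>2 - (f (g x') + q')
        + eb + 2 * l_f * eg + 8 * l_f\<^sup>2 * eJ\<^sup>2 / M"
    unfolding model_fin_def by argo
  moreover have "(norm (grad_map f g g' h M x))\<^sup>2 / (16 * M) = M / 16 * r\<^sup>2"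
    using M_pos by (simp add: grad_map_eq xp_def r_def norm_minus_commute power_mult_distrib power2_eq_square)
  ultimately show ?thesis using that[OF q'] by (simp add: d_def)
qed

section \<open>Summation of the descent along a run\<close>

text \<open>One factor \<open>t\<close> comes from Cauchy--Schwarz on the telescoped displacement,
  the other from the number of summands. This square is the origin of \<open>\<tau>\<^sup>2\<close>
  in the inner batch sizes.\<close>

lemma drift_sum_le:
  fixes x :: "nat \<Rightarrow> real ^ 'n"
  shows "(\<Sum>i<t. (norm (x i - x 0))\<^sup>2) \<le> (real t)\<^sup>2 * (\<Sum>i<t. (norm (x (Suc i) - x i))\<^sup>2)"
proof -
  have "(norm (x i - x 0))\<^sup>2 \<le> real t * (\<Sum>j<t. (norm (x (Suc j) - x j))\<^sup>2)" if "i < t" for i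
  proof -
    have "x i - x 0 = (\<Sum>j<i. x (Suc j) - x j)" by (simp add: sum_lessThan_telescope)
    then have "norm (x i - x 0) \<le> (\<Sum>j<i. norm (x (Suc j) - x j))" by (simp add: norm_sum)
    then have "(norm (x i - x 0))\<^sup>2 \<le> (\<Sum>j<i. norm (x (Suc j) - x j) * 1)\<^sup>2" by (intro power_mono) auto
    also have "\<dots> \<le> (\<Sum>j<i. (norm (x (Suc j) - x j))\<^sup>2) * (\<Sum>j<i. 1\<^sup>2)" by (rule Cauchy_Schwarz_ineq_sum)
    also have "\<dots> \<le> (\<Sum>j<t. (norm (x (Suc j) - x j))\<^sup>2) * real t"
      using that by (intro mult_mono sum_mono2 sum_nonneg) auto
    finally show ?thesis by (simp add: mult.commute)
  qed
  then have "(\<Sum>i<t. (norm (x i - x 0))\<^sup>2) \<le> (\<Sum>i<t. real t * (\<Sum>j<t. (norm (x (Suc j) - x j))\<^sup>2))"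
    by (intro sum_mono) auto
  then show ?thesis by (simp add: power2_eq_square mult.assoc)
qed

text \<open>The drift term in \<open>err\<close> is absorbed: by Cauchy--Schwarz along the inner loop its sum is at
  most the sum of the squared steps, for which \<open>descent_step\<close> pays.\<close>

lemma trajectory_bound:
  fixes x :: "nat \<Rightarrow> nat \<Rightarrow> real ^ 'n"
  assumes K: "0 < K" and t: "0 < t"
    and y0: "h y0 = ereal q0"
    and outer: "\<And>k. k < K \<Longrightarrow> x (Suc k) 0 = x k t"
    and sol: "\<And>k i z. k < K \<Longrightarrow> i < t \<Longrightarrow>
      prox_linear_model f h M (c k i) (J k i) (x k i) (x k (Suc i))
        \<le> prox_linear_model f h M (c k i) (J k i) (x k i) z + ereal eb"
    and err: "\<And>k i. k < K \<Longrightarrow> i < t \<Longrightarrow>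
      2 * l_f * norm (c k i - g (x k i)) + 8 * l_f\<^sup>2 / M * (spectral_norm (J k i - g' (x k i)))\<^sup>2
        \<le> e + M / (5 * (real t)\<^sup>2) * (norm (x k i - x k 0))\<^sup>2"
  shows "(\<Sum>k<K. \<Sum>i<t. (norm (grad_map f g g' h M (x k i)))\<^sup>2)
    \<le> 16 * M * (model_fin (x 0 0) y0 + q0 + M / 4 * (norm (y0 - x 0 0))\<^sup>2 - p
                 + real K * real t * (eb + e))"
proof -
  define G where "G = (\<lambda>k i. (norm (grad_map f g g' h M (x k i)))\<^sup>2 / (16 * M))"
  define d where "d = (\<lambda>k i. (norm (x k (Suc i) - x k i))\<^sup>2)"
  define D where "D = (\<lambda>k i. (norm (x k i - x k 0))\<^sup>2)"
  define \<phi> where "\<phi> = (\<lambda>k i. f (g (x k i)) + real_of_ereal (h (x k i)))"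
  \<comment> \<open>\<open>h\<close> may be infinite at the starting point, where
    \<open>real_of_ereal\<close> would return 0; there the bound through the reference point
    \<open>y0\<close> takes the place of the objective.\<close>
  define V where "V = (\<lambda>k i. if k = 0 \<and> i = 0
    then model_fin (x 0 0) y0 + q0 + M / 4 * (norm (y0 - x 0 0))\<^sup>2 else \<phi> k i)"
  have fin: "\<exists>q. h (x k (Suc i)) = ereal q" if "k < K" "i < t" for k i
    by (rule descent_step[OF y0 order_refl order_refl sol[OF that]]) blast
  have fin': "\<exists>q. h (x k i) = ereal q" if ki: "k < K" "i < t" "\<not> (k = 0 \<and> i = 0)" for k i
  proof (cases i)
    case 0
    then obtain k' where "k = Suc k'" using ki by (cases k) auto
    then show ?thesis using fin[of k' "t - 1"] outer[of k'] ki t 0 by simp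
  next
    case (Suc j)
    then show ?thesis using fin[of k j] ki by simp
  qed
  have step: "G k i + M / 5 * d k i \<le> V k i - V k (Suc i) + eb + e + M / (5 * (real t)\<^sup>2) * D k i"
    if k: "k < K" and i: "i < t" for k i
  proof -
    have "G k i + M / 5 * d k i \<le> V k i - \<phi> k (Suc i) + eb
        + 2 * l_f * norm (c k i - g (x k i)) + 8 * l_f\<^sup>2 / M * (spectral_norm (J k i - g' (x k i)))\<^sup>2"
    proof (cases "k = 0 \<and> i = 0")
      case True
      show ?thesis
        by (rule descent_step[OF y0 order_refl order_refl sol[OF k i]])
          (use True in \<open>simp add: G_def d_def V_def \<phi>_def\<close>)
    next
      case False
      with fin'[OF k i] obtain q where q: "h (x k i) = ereal q" by blast
      show ?thesis
        by (rule descent_step[OF q order_refl order_refl sol[OF k i]])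
          (use False in \<open>auto simp: G_def d_def V_def \<phi>_def model_fin_def q\<close>)
    qed
    then show ?thesis using err[OF k i] by (simp add: V_def D_def)
  qed
  have inner: "(\<Sum>i<t. G k i) \<le> V k 0 - V k t + real t * (eb + e)" if k: "k < K" for k
  proof -
    have "(\<Sum>i<t. G k i + M / 5 * d k i)
        \<le> (\<Sum>i<t. V k i - V k (Suc i) + eb + e + M / (5 * (real t)\<^sup>2) * D k i)"
      using step[OF k] by (intro sum_mono) auto
    also have "\<dots> = V k 0 - V k t + real t * (eb + e) + M / (5 * (real t)\<^sup>2) * (\<Sum>i<t. D k i)"
      using sum_lessThan_telescope'[of "V k" t] by (simp add: sum.distrib sum_distrib_left distrib_left)
    also have "M / (5 * (real t)\<^sup>2) * (\<Sum>i<t. D k i) \<le> M / (5 * (real t)\<^sup>2) * ((real t)\<^sup>2 * (\<Sum>i<t. d k i))"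
      using drift_sum_le[of "x k" t] M_pos by (intro mult_left_mono) (auto simp: D_def d_def)
    also have "\<dots> = (\<Sum>i<t. M / 5 * d k i)"
      using t by (simp add: sum_distrib_left)
    finally show ?thesis by (simp add: sum.distrib)
  qed
  \<comment> \<open>The end of one loop is the start of the next, and \<open>0 < t\<close> keeps the
    index \<open>(k, t)\<close> away from the exceptional \<open>(0, 0)\<close>, so the inner bounds
    telescope over \<open>k\<close>.\<close>
  have "(\<Sum>k<K. \<Sum>i<t. G k i) \<le> (\<Sum>k<K. V k 0 - V (Suc k) 0 + real t * (eb + e))"
  proof (rule sum_mono)
    fix k assume "k \<in> {..<K}"
    then show "(\<Sum>i<t. G k i) \<le> V k 0 - V (Suc k) 0 + real t * (eb + e)"
      using inner[of k] outer[of k] t by (auto simp: V_def \<phi>_def)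
  qed
  also have "\<dots> = V 0 0 - V K 0 + real K * real t * (eb + e)"
    using sum_lessThan_telescope'[of "\<lambda>k. V k 0" K] by (simp add: sum.distrib)
  finally have "(\<Sum>k<K. \<Sum>i<t. G k i) \<le> V 0 0 - V K 0 + real K * real t * (eb + e)" .
  moreover have "p \<le> V K 0"
  proof -
    obtain k where "K = Suc k" using K by (cases K) auto
    then obtain q where "h (x K 0) = ereal q" using fin[of k "t - 1"] outer[of k] t by auto
    then show ?thesis using Phi_ge_real[of "x K 0" q] K by (simp add: V_def \<phi>_def)
  qed
  ultimately have "(\<Sum>k<K. \<Sum>i<t. G k i) \<le> V 0 0 - p + real K * real t * (eb + e)" by simp
  then have "16 * M * (\<Sum>k<K. \<Sum>i<t. G k i) \<le> 16 * M * (V 0 0 - p + real K * real t * (eb + e))"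
    using M_pos by (intro mult_left_mono) auto
  moreover have "16 * M * (\<Sum>k<K. \<Sum>i<t. G k i) = (\<Sum>k<K. \<Sum>i<t. (norm (grad_map f g g' h M (x k i)))\<^sup>2)"
    using M_pos by (simp add: G_def sum_distrib_left)
  ultimately show ?thesis by (simp add: V_def)
qed

end

section \<open>Concentration of fresh batches\<close>

text \<open>Replacing the parameter by approximations \<open>F i\<close> with finitely many values
  leaves finitely many measurable pieces, and continuity passes to the limit. It is needed because
  the components are only known to be measurable at each fixed point, whereas a random iterate has
  to be substituted.\<close>

lemma measurable_Pair_caratheodory:
  fixes \<phi> :: "'s \<Rightarrow> 'p::{second_countable_topology, metric_space} \<Rightarrow> 'b::{metric_space, second_countable_topology}"
  assumes meas: "\<And>p. (\<lambda>\<xi>. \<phi> \<xi> p) \<in> borel_measurable D"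
    and cont: "\<And>\<xi>. \<xi> \<in> space D \<Longrightarrow> continuous_on UNIV (\<phi> \<xi>)"
  shows "(\<lambda>w. \<phi> (fst w) (snd w)) \<in> borel_measurable (D \<Otimes>\<^sub>M borel)"
proof -
  obtain F :: "nat \<Rightarrow> 'p \<Rightarrow> 'p" where F: "\<And>i. simple_function borel (F i)"
    "\<And>x. (\<lambda>i. F i x) \<longlonglongrightarrow> x"
    using borel_measurable_implies_sequence_metric[of "\<lambda>x. x" borel undefined] by auto
  show ?thesis
  proof (rule borel_measurable_LIMSEQ_metric)
    fix i
    have fin: "finite (range (F i))" using F(1)[of i] by (simp add: simple_function_def)
    show "(\<lambda>w. \<phi> (fst w) (F i (snd w))) \<in> borel_measurable (D \<Otimes>\<^sub>M borel)"
    proof (rule measurable_compose_countable'[where I="range (F i)"])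
      show "(\<lambda>w. \<phi> (fst w) p) \<in> borel_measurable (D \<Otimes>\<^sub>M borel)" for p
        using measurable_compose[OF measurable_fst meas] .
      have "F i \<in> measurable borel (count_space (range (F i)))"
        using measurable_simple_function[OF F(1)[of i]] fin
        by (simp add: measurable_count_space_eq2 measurable_count_space_eq2_countable)
          (metis F(1) simple_functionD(2) space_borel Int_UNIV_right)
      then show "(\<lambda>w. F i (snd w)) \<in> measurable (D \<Otimes>\<^sub>M borel) (count_space (range (F i)))"
        using measurable_compose[OF measurable_snd] by blast
      show "countable (range (F i))" using fin by (rule countable_finite)
    qed
  next
    fix w assume "w \<in> space (D \<Otimes>\<^sub>M (borel :: 'p measure))"
    then have "continuous_on UNIV (\<phi> (fst w))" by (intro cont) (auto simp: space_pair_measure)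
    then have "isCont (\<phi> (fst w)) (snd w)" by (simp add: continuous_on_eq_continuous_at)
    then show "(\<lambda>i. \<phi> (fst w) (F i (snd w))) \<longlonglongrightarrow> \<phi> (fst w) (snd w)"
      by (rule isCont_tendsto_compose) (rule F(2))
  qed
qed

lemma closed_supp: "closed (supp D)"
proof -
  have "- supp D = \<Union>{U. open U \<and> emeasure D U = 0}" by (auto simp: supp_def zero_less_iff_neq_zero)
  then have "open (- supp D)" by auto
  then show ?thesis by (simp add: closed_def)
qed

text \<open>The complement of the support is a union of null open sets; by Lindelof countably many
  of them cover it, which is where second countability enters.\<close>

lemma AE_in_supp:
  fixes D :: "'s::second_countable_topology measure"
  assumes "sets D = sets borel"
  shows "AE \<xi> in D. \<xi> \<in> supp D"
proof -
  define \<U> where "\<U> = {U. open U \<and> emeasure D U = 0}"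
  obtain \<V> where V: "\<V> \<subseteq> \<U>" "countable \<V>" "\<Union>\<V> = \<Union>\<U>"
    using Lindelof[of \<U>] by (auto simp: \<U>_def)
  have "(\<Union>U\<in>\<V>. U) \<in> null_sets D"
  proof (rule null_sets_UN')
    show "countable \<V>" by fact
    show "U \<in> null_sets D" if "U \<in> \<V>" for U
      using that V(1) assms by (auto simp: \<U>_def null_sets_def)
  qed
  moreover have "- supp D \<subseteq> \<Union>\<U>" by (auto simp: supp_def \<U>_def zero_less_iff_neq_zero)
  then have "{\<xi> \<in> space D. \<xi> \<notin> supp D} \<subseteq> (\<Union>U\<in>\<V>. U)" using V(3) by auto
  ultimately show ?thesis by (rule AE_I')
qed

section \<open>Hoeffding's inequality at a random parameter\<close>

text \<open>Measuring the threshold in multiples of \<open>c\<close> makes the width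
  \<open>2 * c\<close> of the range cancel in the exponent. This uniformity is what later allows
  \<open>c\<close> to depend on a random parameter.\<close>

lemma hoeffding_iid_bounded:
  assumes "prob_space D" and X: "X \<in> borel_measurable D" and "\<And>\<xi>. \<xi> \<in> space D \<Longrightarrow> \<bar>X \<xi>\<bar> \<le> c"
    and mean: "(LINT \<xi>|D. X \<xi>) = 0" and N: "0 < N" and t: "0 < t"
  shows "measure (PiM {..<N} (\<lambda>_. D)) {v \<in> space (PiM {..<N} (\<lambda>_. D)). t * c < \<bar>batch_mean N (\<lambda>j. X (v j))\<bar>}
    \<le> 2 * exp (- (real N * t\<^sup>2 / 2))"
proof -
  interpret D: prob_space D by fact
  interpret Pi: prob_space "PiM {..<N} (\<lambda>_. D)" by (rule prob_space_PiM) (rule assms(1))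
  obtain \<xi>0 where "\<xi>0 \<in> space D" using D.not_empty by blast
  then have "0 \<le> c" using assms(3)[of \<xi>0] by linarith
  show ?thesis
  proof (cases "c = 0")
    \<comment> \<open>Hoeffding's exponent divides by the width of the range; at width 0 the strict
      inequality makes the event empty.\<close>
    case True
    then have "X \<xi> = 0" if "\<xi> \<in> space D" for \<xi> using assms(3)[OF that] by simp
    then have "batch_mean N (\<lambda>j. X (v j)) = 0" if "v \<in> space (PiM {..<N} (\<lambda>_. D))" for v
      unfolding batch_mean_def using that by (subst sum.neutral) (auto simp: space_PiM PiE_mem)
    then have *: "{v \<in> space (PiM {..<N} (\<lambda>_. D)). t * c < \<bar>batch_mean N (\<lambda>j. X (v j))\<bar>} = {}"
      by (simp add: True cong: conj_cong)
    show ?thesis unfolding * by simp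
  next
    case False
    with \<open>0 \<le> c\<close> have c: "0 < c" by simp
    have distr: "distr (PiM {..<N} (\<lambda>_. D)) D (\<lambda>v. v i) = D" if "i < N" for i
      using distr_PiM_component[of "{..<N}" "\<lambda>_. D" i] assms(1) that by simp
    have ind: "Pi.indep_vars (\<lambda>_. D) (\<lambda>i v. v i) {..<N}"
    proof (subst Pi.indep_vars_iff_distr_eq_PiM')
      show "{..<N} \<noteq> {}" using N by (auto simp: lessThan_empty_iff)
      show "(\<lambda>v. v i) \<in> measurable (PiM {..<N} (\<lambda>_. D)) D" if "i \<in> {..<N}" for i
        using that by measurable
      have "distr (PiM {..<N} (\<lambda>_. D)) (PiM {..<N} (\<lambda>_. D)) (\<lambda>v. \<lambda>i\<in>{..<N}. v i)
          = distr (PiM {..<N} (\<lambda>_. D)) (PiM {..<N} (\<lambda>_. D)) (\<lambda>v. v)"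
        by (rule distr_cong) (auto simp: space_PiM)
      also have "\<dots> = PiM {..<N} (\<lambda>_. D)" by (rule distr_id)
      also have "\<dots> = (\<Pi>\<^sub>M i\<in>{..<N}. distr (PiM {..<N} (\<lambda>_. D)) D (\<lambda>v. v i))"
        by (rule PiM_cong) (auto simp: distr)
      finally show "distr (PiM {..<N} (\<lambda>_. D)) (PiM {..<N} (\<lambda>_. D)) (\<lambda>v. \<lambda>i\<in>{..<N}. v i)
          = (\<Pi>\<^sub>M i\<in>{..<N}. distr (PiM {..<N} (\<lambda>_. D)) D (\<lambda>v. v i))" .
    qed
    interpret H: Hoeffding_ineq "PiM {..<N} (\<lambda>_. D)" "{..<N}" "\<lambda>i v. X (v i)" "\<lambda>_. -c" "\<lambda>_. c"
      "\<Sum>i<N. Pi.expectation (\<lambda>v. X (v i))"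
    proof unfold_locales
      show "Pi.indep_vars (\<lambda>_. borel) (\<lambda>i v. X (v i)) {..<N}"
        by (rule Pi.indep_vars_compose2[OF ind]) (use X in auto)
      show "AE v in PiM {..<N} (\<lambda>_. D). X (v i) \<in> {- c..c}" if "i \<in> {..<N}" for i
      proof (rule AE_I2)
        fix v assume "v \<in> space (PiM {..<N} (\<lambda>_. D))"
        then have "v i \<in> space D" using that by (auto simp: space_PiM)
        then show "X (v i) \<in> {- c..c}" using assms(3)[of "v i"] by auto
      qed
    qed auto
    have "Pi.expectation (\<lambda>v. X (v i)) = 0" if "i < N" for i
      using integral_distr[of "\<lambda>v. v i" "PiM {..<N} (\<lambda>_. D)" D X] X distr[OF that] mean that by simp
    then have mu: "(\<Sum>i<N. Pi.expectation (\<lambda>v. X (v i))) = 0" by simp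
    have "Pi.prob {v \<in> space (PiM {..<N} (\<lambda>_. D)). t * c < \<bar>batch_mean N (\<lambda>j. X (v j))\<bar>}
      \<le> Pi.prob {v \<in> space (PiM {..<N} (\<lambda>_. D)). real N * t * c \<le> \<bar>(\<Sum>i<N. X (v i)) - (\<Sum>i<N. Pi.expectation (\<lambda>v. X (v i)))\<bar>}"
    proof (rule Pi.finite_measure_mono)
      show "{v \<in> space (PiM {..<N} (\<lambda>_. D)). real N * t * c \<le> \<bar>(\<Sum>i<N. X (v i)) - (\<Sum>i<N. Pi.expectation (\<lambda>v. X (v i)))\<bar>}
          \<in> Pi.events" using H.random_variable by measurable
    qed (use N in \<open>auto simp: mu batch_mean_def abs_mult field_simps\<close>)
    also have "\<dots> \<le> 2 * exp (-2 * (real N * t * c)\<^sup>2 / (\<Sum>i<N. (c - - c)\<^sup>2))"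
      by (rule H.Hoeffding_ineq_abs_ge) (use c t N in auto)
    also have "-2 * (real N * t * c)\<^sup>2 / (\<Sum>i<N. (c - - c)\<^sup>2) = - (real N * t\<^sup>2 / 2)"
      using c N by (simp add: power2_eq_square field_simps)
    finally show ?thesis by simp
  qed
qed

text \<open>A fresh batch is independent of the parameter \<open>Y\<close> determined by the past, so by Fubini a
  tail bound that is uniform in a deterministic parameter survives the substitution of \<open>Y\<close>.\<close>

lemma (in prob_space) fresh_batch_deviation:
  fixes Y :: "'a \<Rightarrow> 'p::{second_countable_topology, metric_space}" and D :: "'s measure"
  assumes D: "prob_space D"
    and fresh: "fresh_batch M D \<F> N \<xi>"
    and Y: "\<And>S. S \<in> sets borel \<Longrightarrow> Y -` S \<inter> space M \<in> \<F>"
    and \<phi>: "(\<lambda>w. \<phi> (fst w) (snd w)) \<in> borel_measurable (D \<Otimes>\<^sub>M (borel :: 'p measure))"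
    and c: "c \<in> borel_measurable borel"
    and bound: "\<And>\<xi> p. \<xi> \<in> space D \<Longrightarrow> \<bar>\<phi> \<xi> p\<bar> \<le> c p"
    and mean: "\<And>p. (LINT \<xi>|D. \<phi> \<xi> p) = 0"
    and N: "0 < N" and t: "0 < t"
  defines "B \<equiv> {\<omega> \<in> space M. t * c (Y \<omega>) < \<bar>batch_mean N (\<lambda>j. \<phi> (\<xi> j \<omega>) (Y \<omega>))\<bar>}"
  shows "B \<in> events" "prob B \<le> 2 * exp (- (real N * t\<^sup>2 / 2))"
proof -
  let ?PD = "PiM {..<N} (\<lambda>_. D)"
  define Z where "Z = (\<lambda>\<omega>. \<lambda>j\<in>{..<N}. \<xi> j \<omega>)"
  define S where "S = {w \<in> space (borel \<Otimes>\<^sub>M ?PD). t * c (fst w) < \<bar>batch_mean N (\<lambda>j. \<phi> (snd w j) (fst w))\<bar>}"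
  have \<xi>: "\<And>j. j < N \<Longrightarrow> \<xi> j \<in> measurable M D" "\<And>j. j < N \<Longrightarrow> distr M D (\<xi> j) = D"
    and ind: "indep_vars (\<lambda>_. D) \<xi> {..<N}"
    and inds: "indep_set \<F> (sets (vimage_algebra (space M) Z ?PD))"
    using fresh unfolding fresh_batch_def Z_def by auto
  interpret PD: prob_space ?PD by (rule prob_space_PiM) (rule assms(1))
  \<comment> \<open>\<open>indep_set\<close> includes that the members of \<open>\<F>\<close> are
    events.\<close>
  have Y_meas: "Y \<in> measurable M borel"
    using Y inds by (auto simp: measurable_def indep_set_def indep_sets_def split: bool.splits)
  have Z_meas: "Z \<in> measurable M ?PD" unfolding Z_def using \<xi>(1) by (intro measurable_restrict) auto
  have "distr M ?PD Z = (\<Pi>\<^sub>M i\<in>{..<N}. distr M D (\<xi> i))"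
    unfolding Z_def
    by (rule iffD1[OF indep_vars_iff_distr_eq_PiM' ind]) (use \<xi>(1) N in \<open>auto simp: lessThan_empty_iff\<close>)
  also have "\<dots> = ?PD" by (rule PiM_cong) (use \<xi>(2) in auto)
  finally have Z_distr: "distr M ?PD Z = ?PD" .
  have YZ: "(\<lambda>\<omega>. (Y \<omega>, Z \<omega>)) \<in> measurable M (borel \<Otimes>\<^sub>M ?PD)"
    using Y_meas Z_meas by (rule measurable_Pair)
  \<comment> \<open>Independence on rectangles: the joint law of \<open>Y\<close> and the batch is a
    product, so the tail may be computed with the parameter frozen.\<close>
  have joint: "distr M borel Y \<Otimes>\<^sub>M ?PD = distr M (borel \<Otimes>\<^sub>M ?PD) (\<lambda>\<omega>. (Y \<omega>, Z \<omega>))"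
  proof (rule pair_measure_eqI)
    show "sigma_finite_measure (distr M borel Y)"
      using prob_space_distr[OF Y_meas] by (rule prob_space_imp_sigma_finite)
    show "sigma_finite_measure ?PD" ..
    show "sets (distr M borel Y \<Otimes>\<^sub>M ?PD) = sets (distr M (borel \<Otimes>\<^sub>M ?PD) (\<lambda>\<omega>. (Y \<omega>, Z \<omega>)))"
      by (simp cong: sets_pair_measure_cong)
    fix U V assume U: "U \<in> sets (distr M borel Y)" and V: "V \<in> sets ?PD"
    have "Z -` V \<inter> space M \<in> sets (vimage_algebra (space M) Z ?PD)"
      using V by (rule in_vimage_algebra)
    then have "prob ((Y -` U \<inter> space M) \<inter> (Z -` V \<inter> space M))
        = prob (Y -` U \<inter> space M) * prob (Z -` V \<inter> space M)"
      using U Y by (intro indep_setD[OF inds]) auto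
    moreover have "(\<lambda>\<omega>. (Y \<omega>, Z \<omega>)) -` (U \<times> V) \<inter> space M = (Y -` U \<inter> space M) \<inter> (Z -` V \<inter> space M)"
      by auto
    moreover have "emeasure ?PD V = emeasure M (Z -` V \<inter> space M)"
      using emeasure_distr[OF Z_meas V] by (simp only: Z_distr)
    ultimately show "emeasure (distr M borel Y) U * emeasure ?PD V
        = emeasure (distr M (borel \<Otimes>\<^sub>M ?PD) (\<lambda>\<omega>. (Y \<omega>, Z \<omega>))) (U \<times> V)"
      using U V Y_meas YZ by (simp add: emeasure_distr emeasure_eq_measure ennreal_mult)
  qed
  have S: "S \<in> sets (borel \<Otimes>\<^sub>M ?PD)"
  proof -
    have "(\<lambda>w. \<phi> (snd w j) (fst w)) \<in> borel_measurable (borel \<Otimes>\<^sub>M ?PD)" if "j < N" for j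
    proof -
      have "(\<lambda>w. (snd w j, fst w)) \<in> measurable (borel \<Otimes>\<^sub>M ?PD) (D \<Otimes>\<^sub>M (borel :: 'p measure))"
        using that
        by (intro measurable_Pair measurable_fst measurable_compose[OF measurable_snd measurable_component_singleton]) auto
      from measurable_compose[OF this \<phi>] show ?thesis by simp
    qed
    then have "(\<lambda>w. \<bar>batch_mean N (\<lambda>j. \<phi> (snd w j) (fst w))\<bar>) \<in> borel_measurable (borel \<Otimes>\<^sub>M ?PD)"
      unfolding batch_mean_def by (intro borel_measurable_abs borel_measurable_scaleR borel_measurable_sum) auto
    moreover have "(\<lambda>w. t * c (fst w)) \<in> borel_measurable (borel \<Otimes>\<^sub>M ?PD)"
      by (intro borel_measurable_times measurable_compose[OF measurable_fst c]) simp
    ultimately show ?thesis unfolding S_def by (rule borel_measurable_less[rotated])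
  qed
  have B: "B = (\<lambda>\<omega>. (Y \<omega>, Z \<omega>)) -` S \<inter> space M"
    using measurable_space[OF YZ] by (auto simp: B_def S_def Z_def batch_mean_def)
  show "B \<in> events" unfolding B using YZ S by (rule measurable_sets)
  have "emeasure M B = emeasure (distr M borel Y \<Otimes>\<^sub>M ?PD) S"
    unfolding B joint using YZ S by (simp add: emeasure_distr)
  also have "\<dots> = (\<integral>\<^sup>+p. emeasure ?PD (Pair p -` S) \<partial>distr M borel Y)"
    using S by (intro PD.emeasure_pair_measure_alt) (simp cong: sets_pair_measure_cong)
  \<comment> \<open>For frozen \<open>p\<close> the inner measure is a Hoeffding tail whose bound
    does not involve \<open>p\<close>.\<close>
  also have "\<dots> \<le> (\<integral>\<^sup>+p. ennreal (2 * exp (- (real N * t\<^sup>2 / 2))) \<partial>distr M borel Y)"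
  proof (rule nn_integral_mono)
    fix p
    have "Pair p -` S = {v \<in> space ?PD. t * c p < \<bar>batch_mean N (\<lambda>j. \<phi> (v j) p)\<bar>}"
      by (auto simp: S_def space_pair_measure)
    moreover have "(\<lambda>\<xi>. \<phi> \<xi> p) \<in> borel_measurable D"
    proof -
      have "(\<lambda>\<xi>. (\<xi>, p)) \<in> measurable D (D \<Otimes>\<^sub>M (borel :: 'p measure))" by measurable
      from measurable_compose[OF this \<phi>] show ?thesis by simp
    qed
    then have "measure ?PD {v \<in> space ?PD. t * c p < \<bar>batch_mean N (\<lambda>j. \<phi> (v j) p)\<bar>}
        \<le> 2 * exp (- (real N * t\<^sup>2 / 2))"
      using D bound mean N t by (intro hoeffding_iid_bounded) auto
    ultimately show "emeasure ?PD (Pair p -` S) \<le> ennreal (2 * exp (- (real N * t\<^sup>2 / 2)))"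
      by (simp add: PD.emeasure_eq_measure ennreal_leI)
  qed
  also have "\<dots> = ennreal (2 * exp (- (real N * t\<^sup>2 / 2)))"
    using prob_space.emeasure_space_1[OF prob_space_distr[OF Y_meas]] by simp
  finally show "prob B \<le> 2 * exp (- (real N * t\<^sup>2 / 2))"
    by (simp add: emeasure_eq_measure)
qed

text \<open>Outside \<open>supp D\<close> nothing is known about the components, so \<open>\<phi>\<close> is replaced by \<open>0\<close> there;
  almost every sample lies in \<open>supp D\<close>.\<close>

lemma (in prob_space) fresh_batch_event:
  fixes Y :: "'a \<Rightarrow> 'p::{second_countable_topology, metric_space}"
    and D :: "'s::second_countable_topology measure"
    and \<psi> :: "'s \<Rightarrow> 'p \<Rightarrow> 'v::euclidean_space"
  assumes D: "prob_space D" and D_borel: "sets D = sets borel"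
    and fresh: "fresh_batch M D \<F> N \<xi>"
    and Y: "\<And>S. S \<in> sets borel \<Longrightarrow> Y -` S \<inter> space M \<in> \<F>"
    and int: "\<And>p. integrable D (\<lambda>\<xi>. \<psi> \<xi> p)"
    and mean: "\<And>p. (LINT \<xi>|D. \<psi> \<xi> p) = 0"
    and cont: "\<And>\<xi>. \<xi> \<in> supp D \<Longrightarrow> continuous_on UNIV (\<psi> \<xi>)"
    and c: "c \<in> borel_measurable borel" and c_nonneg: "\<And>p. 0 \<le> c p"
    and bound: "\<And>\<xi> p b. \<xi> \<in> supp D \<Longrightarrow> b \<in> Basis \<Longrightarrow> \<bar>\<psi> \<xi> p \<bullet> b\<bar> \<le> c p"
    and N: "0 < N" and t: "0 < t"
  shows "holds_with_prob M (1 - 2 * real DIM('v) * exp (- (real N * t\<^sup>2 / 2)))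
    (\<lambda>\<omega>. norm (batch_mean N (\<lambda>j. \<psi> (\<xi> j \<omega>) (Y \<omega>))) \<le> real DIM('v) * t * c (Y \<omega>))"
proof -
  define \<phi> where "\<phi> = (\<lambda>b \<xi> p. \<psi> \<xi> p \<bullet> b)"
  have meas: "(\<lambda>\<xi>. \<phi> i \<xi> p) \<in> borel_measurable D" for i p
    unfolding \<phi>_def using int by (intro borel_measurable_inner borel_measurable_integrable) auto
  define \<phi>' where "\<phi>' = (\<lambda>i \<xi> p. indicator (supp D) \<xi> * \<phi> i \<xi> p)"
  have supp: "supp D \<in> sets D" using closed_supp[of D] D_borel by simp
  have meas': "(\<lambda>\<xi>. \<phi>' i \<xi> p) \<in> borel_measurable D" for i p
    unfolding \<phi>'_def using supp meas by measurable
  have joint: "(\<lambda>w. \<phi>' i (fst w) (snd w)) \<in> borel_measurable (D \<Otimes>\<^sub>M (borel :: 'p measure))" for i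
  proof (rule measurable_Pair_caratheodory[OF meas'])
    show "continuous_on UNIV (\<phi>' i \<xi>)" for \<xi>
      using cont[of \<xi>] by (cases "\<xi> \<in> supp D") (auto simp: \<phi>'_def \<phi>_def intro!: continuous_intros)
  qed
  define B where "B = (\<lambda>i. {\<omega> \<in> space M. t * c (Y \<omega>) < \<bar>batch_mean N (\<lambda>j. \<phi>' i (\<xi> j \<omega>) (Y \<omega>))\<bar>})"
  have bd: "\<bar>\<phi>' i \<xi> p\<bar> \<le> c p" if "i \<in> Basis" for i \<xi> p
    using bound[of \<xi> i p] that c_nonneg[of p] by (cases "\<xi> \<in> supp D") (auto simp: \<phi>'_def \<phi>_def)
  have mn: "(LINT \<xi>|D. \<phi>' i \<xi> p) = 0" for i p
  proof -
    have "(LINT \<xi>|D. \<phi>' i \<xi> p) = (LINT \<xi>|D. \<phi> i \<xi> p)"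
      using AE_in_supp[OF D_borel] by (intro integral_cong_AE meas meas') (auto simp: \<phi>'_def)
    then show ?thesis using int mean by (simp add: \<phi>_def)
  qed
  have B: "B i \<in> events" "prob (B i) \<le> 2 * exp (- (real N * t\<^sup>2 / 2))" if "i \<in> Basis" for i
    unfolding B_def using fresh_batch_deviation[OF D fresh Y joint c bd[OF that] mn N t] by auto
  \<comment> \<open>On \<open>E0\<close> the truncated \<open>\<phi>'\<close> agrees with
    \<open>\<phi>\<close> at every sample of the batch, so control of the truncated means is control
    of those of \<open>\<psi>\<close>.\<close>
  define E0 where "E0 = {\<omega> \<in> space M. \<forall>j<N. \<xi> j \<omega> \<in> supp D}"
  have \<xi>: "\<xi> j \<in> measurable M D" "distr M D (\<xi> j) = D" if "j < N" for j
    using fresh that unfolding fresh_batch_def by auto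
  have "AE \<omega> in M. \<xi> j \<omega> \<in> supp D" if "j < N" for j
  proof -
    have "AE x in distr M D (\<xi> j). x \<in> supp D"
      unfolding \<xi>(2)[OF that] by (rule AE_in_supp[OF D_borel])
    then show ?thesis using \<xi>(1)[OF that] supp by (subst (asm) AE_distr_iff) auto
  qed
  then have AE: "AE \<omega> in M. \<forall>j<N. \<xi> j \<omega> \<in> supp D" by (subst AE_all_countable) auto
  have E0: "E0 \<in> events"
  proof -
    have "E0 = space M \<inter> (\<Inter>j\<in>{..<N}. \<xi> j -` supp D \<inter> space M)" using N by (auto simp: E0_def)
    also have "\<dots> \<in> events"
      using \<xi>(1) supp N by (intro sets.Int sets.top sets.finite_INT measurable_sets) (auto simp: lessThan_empty_iff)
    finally show ?thesis .
  qed
  have "prob E0 = 1"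
    using AE unfolding E0_def by (rule iffD2[OF prob_Collect_eq_1, OF E0[unfolded E0_def]])
  \<comment> \<open>The union over coordinates puts a factor \<open>DIM('v)\<close> into the
    probability; the one in the threshold arises below from bounding the norm by the l1
    norm.\<close>
  define U where "U = (\<Union>i\<in>Basis. B i)"
  define E where "E = E0 - U"
  have U: "U \<in> events" unfolding U_def using B(1) by (intro sets.finite_UN) auto
  have "prob U \<le> (\<Sum>i\<in>Basis. prob (B i))"
    unfolding U_def using B(1) by (intro finite_measure_subadditive_finite) auto
  also have "\<dots> \<le> (\<Sum>i\<in>(Basis::'v set). 2 * exp (- (real N * t\<^sup>2 / 2)))" by (intro sum_mono B(2))
  finally have "prob U \<le> 2 * real DIM('v) * exp (- (real N * t\<^sup>2 / 2))" by simp
  moreover have "prob E0 \<le> prob E + prob U"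
  proof -
    have "prob E0 \<le> prob (E \<union> U)"
      using E0 U by (intro finite_measure_mono) (auto simp: E_def)
    also have "\<dots> \<le> prob E + prob U"
      using E0 U by (intro measure_Un_le) (auto simp: E_def)
    finally show ?thesis .
  qed
  ultimately have pE: "1 - 2 * real DIM('v) * exp (- (real N * t\<^sup>2 / 2)) \<le> prob E"
    using \<open>prob E0 = 1\<close> by linarith
  have "norm (batch_mean N (\<lambda>j. \<psi> (\<xi> j \<omega>) (Y \<omega>))) \<le> real DIM('v) * t * c (Y \<omega>)" if "\<omega> \<in> E" for \<omega>
  proof -
    have "\<omega> \<in> space M" "\<omega> \<notin> U" and supp': "\<And>j. j < N \<Longrightarrow> \<xi> j \<omega> \<in> supp D"
      using that by (auto simp: E_def E0_def)
    have "\<bar>batch_mean N (\<lambda>j. \<psi> (\<xi> j \<omega>) (Y \<omega>)) \<bullet> b\<bar> \<le> t * c (Y \<omega>)" if "b \<in> Basis" for b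
    proof -
      have "batch_mean N (\<lambda>j. \<psi> (\<xi> j \<omega>) (Y \<omega>)) \<bullet> b = batch_mean N (\<lambda>j. \<phi>' b (\<xi> j \<omega>) (Y \<omega>))"
        using supp' by (simp add: batch_mean_def \<phi>'_def \<phi>_def inner_sum_left)
      moreover have "\<omega> \<notin> B b" using \<open>\<omega> \<notin> U\<close> that by (auto simp: U_def)
      ultimately show ?thesis using \<open>\<omega> \<in> space M\<close> by (simp add: B_def not_less)
    qed
    then have "(\<Sum>b\<in>Basis. \<bar>batch_mean N (\<lambda>j. \<psi> (\<xi> j \<omega>) (Y \<omega>)) \<bullet> b\<bar>) \<le> (\<Sum>b\<in>(Basis::'v set). t * c (Y \<omega>))"
      by (intro sum_mono)
    then show ?thesis
      using norm_le_l1[of "batch_mean N (\<lambda>j. \<psi> (\<xi> j \<omega>) (Y \<omega>))"] by simp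
  qed
  then show ?thesis unfolding holds_with_prob_def using E0 U pE by (intro bexI[of _ E]) (auto simp: E_def)
qed

section \<open>Union bounds for events of high probability\<close>

lemma holds_with_prob_mono:
  assumes "holds_with_prob P p Q" "q \<le> p" "\<And>\<omega>. \<omega> \<in> space P \<Longrightarrow> Q \<omega> \<Longrightarrow> R \<omega>"
  shows "holds_with_prob P q R"
proof -
  obtain E where "E \<in> sets P" "p \<le> measure P E" "\<forall>\<omega>\<in>E. Q \<omega>"
    using assms(1) by (auto simp: holds_with_prob_def)
  then show ?thesis using assms(2,3) sets.sets_into_space[of E P]
    unfolding holds_with_prob_def by (intro bexI[of _ E]) auto
qed

lemma (in prob_space) holds_with_prob_conj:
  assumes "holds_with_prob M (1 - p) Q" "holds_with_prob M (1 - q) R"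
  shows "holds_with_prob M (1 - (p + q)) (\<lambda>\<omega>. Q \<omega> \<and> R \<omega>)"
proof -
  obtain E F where E: "E \<in> events" "1 - p \<le> prob E" "\<forall>\<omega>\<in>E. Q \<omega>"
    and F: "F \<in> events" "1 - q \<le> prob F" "\<forall>\<omega>\<in>F. R \<omega>"
    using assms by (auto simp: holds_with_prob_def)
  have "prob (E \<union> F) = prob E + prob F - prob (E \<inter> F)"
    using measure_Un3[of E M F] E F by (simp add: fmeasurable_eq_sets)
  moreover have "prob (E \<union> F) \<le> 1" by simp
  ultimately have "1 - (p + q) \<le> prob (E \<inter> F)" using E F by linarith
  then show ?thesis using E F unfolding holds_with_prob_def by (intro bexI[of _ "E \<inter> F"]) auto
qed

lemma (in prob_space) holds_with_prob_ball:
  assumes "finite I" "\<And>i. i \<in> I \<Longrightarrow> holds_with_prob M (1 - p i) (Q i)"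
  shows "holds_with_prob M (1 - (\<Sum>i\<in>I. p i)) (\<lambda>\<omega>. \<forall>i\<in>I. Q i \<omega>)"
  using assms
proof (induction I rule: finite_induct)
  case empty
  show ?case unfolding holds_with_prob_def by (intro bexI[of _ "space M"]) (auto simp: prob_space)
next
  case (insert i I)
  then have "holds_with_prob M (1 - (p i + (\<Sum>i\<in>I. p i))) (\<lambda>\<omega>. Q i \<omega> \<and> (\<forall>i\<in>I. Q i \<omega>))"
    by (intro holds_with_prob_conj) auto
  then show ?case using insert by simp
qed

section \<open>Errors of the estimators\<close>

lemma spectral_norm_le_norm:
  fixes A :: "real ^ 'n ^ 'm"
  shows "spectral_norm A \<le> norm A"
  unfolding spectral_norm_def
proof (rule onorm_le)
  fix v
  have "norm (A *v v) = L2_set (\<lambda>i. \<bar>A $ i \<bullet> v\<bar>) UNIV"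
    by (simp add: norm_vec_def matrix_vector_mul_component)
  also have "\<dots> \<le> L2_set (\<lambda>i. norm (A $ i) * norm v) UNIV"
    by (rule L2_set_mono) (auto simp: Cauchy_Schwarz_ineq2)
  also have "\<dots> = norm A * norm v"
    by (simp add: L2_set_left_distrib norm_vec_def)
  finally show "norm (A *v v) \<le> norm A * norm v" .
qed

text \<open>Inner products with basis matrices are entries; this turns the spectral hypotheses into
  the coordinatewise ranges that Hoeffding's inequality takes.\<close>

lemma inner_Basis_le_spectral_norm:
  fixes A :: "real ^ 'n ^ 'm"
  assumes "b \<in> Basis"
  shows "\<bar>A \<bullet> b\<bar> \<le> spectral_norm A"
proof -
  obtain i u where b: "b = axis i u" and u: "u \<in> (Basis :: (real ^ 'n) set)"
    using assms by (auto simp: Basis_vec_def)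
  obtain j where "u = axis j 1" using u by (auto simp: Basis_vec_def)
  then have "A \<bullet> b = A $ i $ j" by (simp add: b inner_axis)
  then show ?thesis using component_le_spectral_norm[of A i j] by simp
qed

lemma norm_le_spectral_norm:
  fixes A :: "real ^ 'n ^ 'm"
  shows "norm A \<le> real CARD('m) * real CARD('n) * spectral_norm A"
proof -
  have "norm A \<le> (\<Sum>b\<in>Basis. \<bar>A \<bullet> b\<bar>)" by (rule norm_le_l1)
  also have "\<dots> \<le> (\<Sum>b\<in>(Basis :: (real ^ 'n ^ 'm) set). spectral_norm A)"
    by (intro sum_mono inner_Basis_le_spectral_norm)
  finally show ?thesis by simp
qed

text \<open>The topology of matrices comes from the Frobenius norm, while the hypotheses use the
  spectral norm; equivalence of the two, with a dimensional constant, bridges the gap.\<close>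

lemma continuous_on_of_spectral_lipschitz:
  fixes F :: "real ^ 'k \<Rightarrow> real ^ 'n ^ 'm"
  assumes "\<And>x y. spectral_norm (F x - F y) \<le> L * norm (x - y)"
  shows "continuous_on UNIV F"
proof -
  \<comment> \<open>\<open>lipschitz_on\<close> demands a nonnegative constant, hence the absolute
    value.\<close>
  define C where "C = real CARD('m) * real CARD('n) * \<bar>L\<bar>"
  have "C-lipschitz_on UNIV F"
  proof (rule lipschitz_onI)
    fix x y
    have "dist (F x) (F y) \<le> real CARD('m) * real CARD('n) * spectral_norm (F x - F y)"
      unfolding dist_norm by (rule norm_le_spectral_norm)
    also have "\<dots> \<le> real CARD('m) * real CARD('n) * (\<bar>L\<bar> * norm (x - y))"
    proof (intro mult_left_mono)
      have "L * norm (x - y) \<le> \<bar>L\<bar> * norm (x - y)" by (intro mult_right_mono) auto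
      then show "spectral_norm (F x - F y) \<le> \<bar>L\<bar> * norm (x - y)" using assms[of x y] by linarith
    qed auto
    finally show "dist (F x) (F y) \<le> C * dist x y" by (simp add: C_def dist_norm mult.assoc)
  qed (simp add: C_def)
  then show ?thesis by (rule lipschitz_on_continuous_on)
qed

lemma batch_mean_diff_const: "0 < N \<Longrightarrow> batch_mean N (\<lambda>j. v j - c) = batch_mean N v - c"
  by (simp add: batch_mean_def sum_subtractf scaleR_diff_right scaleR_sum_right sum_constant_scaleR)

text \<open>Centring reduces this to \<open>fresh_batch_event\<close>. The abstract parameter covers
  all four estimates: a single point with constant \<open>c\<close>, or a pair of points with
  \<open>c\<close> proportional to their distance.\<close>

lemma (in prob_space) batch_mean_error:
  fixes Y :: "'a \<Rightarrow> 'p::{second_countable_topology, metric_space}"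
    and D :: "'s::second_countable_topology measure"
    and s :: "'s \<Rightarrow> 'p \<Rightarrow> 'v::euclidean_space"
  assumes D: "prob_space D" "sets D = sets borel"
    and fresh: "fresh_batch M D \<F> N \<xi>"
    and Y: "\<And>S. S \<in> sets borel \<Longrightarrow> Y -` S \<inter> space M \<in> \<F>"
    and int: "\<And>p. integrable D (\<lambda>\<xi>. s \<xi> p)"
    and mean: "\<And>p. m p = (LINT \<xi>|D. s \<xi> p)"
    and cont: "\<And>\<xi>. \<xi> \<in> supp D \<Longrightarrow> continuous_on UNIV (s \<xi>)" "continuous_on UNIV m"
    and c: "c \<in> borel_measurable borel" "\<And>p. 0 \<le> c p"
    and bound: "\<And>\<xi> p b. \<xi> \<in> supp D \<Longrightarrow> b \<in> Basis \<Longrightarrow> \<bar>(s \<xi> p - m p) \<bullet> b\<bar> \<le> c p"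
    and N: "0 < N" and t: "0 < t"
  shows "holds_with_prob M (1 - 2 * real DIM('v) * exp (- (real N * t\<^sup>2 / 2)))
    (\<lambda>\<omega>. norm (batch_mean N (\<lambda>j. s (\<xi> j \<omega>) (Y \<omega>)) - m (Y \<omega>)) \<le> real DIM('v) * t * c (Y \<omega>))"
proof -
  interpret D: prob_space D by fact
  have "holds_with_prob M (1 - 2 * real DIM('v) * exp (- (real N * t\<^sup>2 / 2)))
    (\<lambda>\<omega>. norm (batch_mean N (\<lambda>j. s (\<xi> j \<omega>) (Y \<omega>) - m (Y \<omega>))) \<le> real DIM('v) * t * c (Y \<omega>))"
  proof (rule fresh_batch_event[OF D fresh Y])
    show "integrable D (\<lambda>\<xi>. s \<xi> p - m p)" for p using int by simp
    show "(LINT \<xi>|D. s \<xi> p - m p) = 0" for p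
      using int[of p] mean[of p] by (simp add: D.prob_space)
    show "continuous_on UNIV (\<lambda>p. s \<xi> p - m p)" if "\<xi> \<in> supp D" for \<xi>
      using cont that by (intro continuous_intros) auto
  qed (use c bound N t in auto)
  then show ?thesis using N by (simp add: batch_mean_diff_const)
qed

section \<open>Iterates as functions of the past\<close>

text \<open>Allows \<open>past_events\<close> to be read as the \<open>sets\<close> of a measure
  space, so that the measurability calculus applies to it.\<close>

lemma past_events_eq_sigma_sets:
  obtains G where "G \<subseteq> Pow (space P)" "past_events P D \<tau>s sA sB X \<xi>A \<xi>B k i = sigma_sets (space P) G"
proof -
  have *: "sets (vimage_algebra (space P) f N) \<subseteq> Pow (space P)" for f and N :: "'z measure"
    using sets.space_closed[of "vimage_algebra (space P) f N"] by simp
  show ?thesis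
    by (rule that[OF _ past_events_def]) (unfold split_beta, intro Un_least UN_least *)
qed

lemma past_events_vimage:
  assumes "S \<in> sets borel" "i' \<le> i"
  shows "X k i' -` S \<inter> space P \<in> past_events P D \<tau>s sA sB X \<xi>A \<xi>B k i"
proof -
  have "X k i' -` S \<inter> space P \<in> sets (vimage_algebra (space P) (X k i') borel)"
    using assms(1) by (rule in_vimage_algebra)
  then show ?thesis unfolding past_events_def using assms(2)
    by (intro sigma_sets.Basic UnI1 UN_I[of "(k, i')"]) auto
qed

text \<open>An inner correction involves the current point and the first point of the loop jointly,
  so their pair must be determined by the past, not just each of them.\<close>

lemma past_events_vimage_pair:
  assumes "S \<in> sets borel" "i' \<le> i" "i'' \<le> i"
  shows "(\<lambda>\<omega>. (X k i' \<omega>, X k i'' \<omega>)) -` S \<inter> space P \<in> past_events P D \<tau>s sA sB X \<xi>A \<xi>B k i"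
proof -
  obtain G where G: "G \<subseteq> Pow (space P)" "past_events P D \<tau>s sA sB X \<xi>A \<xi>B k i = sigma_sets (space P) G"
    by (rule past_events_eq_sigma_sets)
  define N where "N = sigma (space P) G"
  have sets: "sets N = past_events P D \<tau>s sA sB X \<xi>A \<xi>B k i" and space: "space N = space P"
    using G by (simp_all add: N_def sets_measure_of space_measure_of)
  have "X k j \<in> borel_measurable N" if "j \<le> i" for j
    using past_events_vimage[OF _ that] by (intro measurableI) (auto simp: sets space)
  then have "(\<lambda>\<omega>. (X k i' \<omega>, X k i'' \<omega>)) \<in> borel_measurable N"
    using assms by (intro borel_measurable_Pair) auto
  from measurable_sets[OF this assms(1)] show ?thesis by (simp add: sets space)
qed

text \<open>Assumptions (V) and (UL) appear here in the form used for concentration: the ranges of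
  centred components and of centred increments. The constants are taken positive because the
  deviation thresholds will divide by them.\<close>

locale composite_run =
  prox_linear f g g' h l_f l_g L_g M p +
  stochastic_components g g' D gs gs' +
  algorithm_run P f h D gs gs' x_init M K "\<lambda>_. \<tau>" A B a b solver eps_bar delta_bar seed X gt Jt \<xi>A \<xi>B
  for f :: "real ^ 'm \<Rightarrow> real"
    and g :: "real ^ 'n \<Rightarrow> real ^ 'm"
    and g' :: "real ^ 'n \<Rightarrow> real ^ 'n ^ 'm"
    and h :: "real ^ 'n \<Rightarrow> ereal"
    and l_f l_g L_g M p :: real
    and D :: "'s::second_countable_topology measure"
    and gs :: "'s \<Rightarrow> real ^ 'n \<Rightarrow> real ^ 'm"
    and gs' :: "'s \<Rightarrow> real ^ 'n \<Rightarrow> real ^ 'n ^ 'm"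
    and P :: "'w measure"
    and x_init :: "real ^ 'n"
    and K \<tau> A B a b :: nat
    and solver :: "(real ^ 'n \<Rightarrow> ereal) \<Rightarrow> real \<Rightarrow> real \<Rightarrow> 'r \<Rightarrow> real ^ 'n"
    and eps_bar delta_bar :: real
    and seed :: "nat \<Rightarrow> nat \<Rightarrow> 'w \<Rightarrow> 'r"
    and X :: "nat \<Rightarrow> nat \<Rightarrow> 'w \<Rightarrow> real ^ 'n"
    and gt :: "nat \<Rightarrow> nat \<Rightarrow> 'w \<Rightarrow> real ^ 'm"
    and Jt :: "nat \<Rightarrow> nat \<Rightarrow> 'w \<Rightarrow> real ^ 'n ^ 'm"
    and \<xi>A \<xi>B :: "nat \<Rightarrow> nat \<Rightarrow> nat \<Rightarrow> 'w \<Rightarrow> 's" +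
  fixes \<sigma> \<sigma>' l l' :: real
  assumes dev_g: "\<And>\<xi> x. \<xi> \<in> supp D \<Longrightarrow> norm (gs \<xi> x - g x) \<le> \<sigma>"
    and dev_J: "\<And>\<xi> x. \<xi> \<in> supp D \<Longrightarrow> spectral_norm (gs' \<xi> x - g' x) \<le> \<sigma>'"
    and lip_g: "\<And>\<xi> x y. \<xi> \<in> supp D \<Longrightarrow>
      norm ((gs \<xi> x - gs \<xi> y) - (g x - g y)) \<le> l * norm (x - y)"
    and lip_J: "\<And>\<xi> x y. \<xi> \<in> supp D \<Longrightarrow>
      spectral_norm ((gs' \<xi> x - gs' \<xi> y) - (g' x - g' y)) \<le> l' * norm (x - y)"
    and cont_gs': "\<And>\<xi>. \<xi> \<in> supp D \<Longrightarrow> continuous_on UNIV (gs' \<xi>)"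
    and pos: "0 < \<sigma>" "0 < \<sigma>'" "0 < l" "0 < l'"
    and sizes: "0 < K" "0 < \<tau>" "0 < A" "0 < B" "0 < a" "0 < b"
begin

lemma cont_gs: "\<xi> \<in> supp D \<Longrightarrow> continuous_on S (gs \<xi>)"
  by (rule has_derivative_continuous_on) (rule has_derivative_at_withinI[OF gs_derivative])

lemma cont_g: "continuous_on S g"
  by (rule has_derivative_continuous_on) (rule has_derivative_at_withinI[OF g_derivative])

lemma cont_g': "continuous_on UNIV g'"
  using g'_lipschitz by (rule continuous_on_of_spectral_lipschitz)

lemma value_estimate_outer:
  assumes k: "k < K" and t: "0 < t"
  shows "holds_with_prob P (1 - 2 * real CARD('m) * exp (- (real A * t\<^sup>2 / 2)))
    (\<lambda>\<omega>. norm (gt k 0 \<omega> - g (X k 0 \<omega>)) \<le> real CARD('m) * t * \<sigma>)"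
proof -
  have "holds_with_prob P (1 - 2 * real DIM(real ^ 'm) * exp (- (real A * t\<^sup>2 / 2)))
    (\<lambda>\<omega>. norm (batch_mean A (\<lambda>j. gs (\<xi>A k 0 j \<omega>) (X k 0 \<omega>)) - g (X k 0 \<omega>)) \<le> real DIM(real ^ 'm) * t * \<sigma>)"
  proof (rule batch_mean_error[where c="\<lambda>_. \<sigma>" and s=gs, OF D_prob D_borel _ past_events_vimage])
    show "fresh_batch P D (past_events P D (\<lambda>_. \<tau>) (per_iter A a) (per_iter B b) X \<xi>A \<xi>B k 0) A (\<xi>A k 0)"
      using batch_A[OF k, of 0] sizes by (simp add: per_iter_def[of A a 0])
    show "\<bar>(gs \<xi> x - g x) \<bullet> u\<bar> \<le> \<sigma>" if "\<xi> \<in> supp D" "u \<in> Basis" for \<xi> x u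
      using Basis_le_norm[OF that(2)] dev_g[OF that(1)] order_trans by blast
  qed (use gs_integrable gs_mean cont_gs cont_g pos sizes t in auto)
  then show ?thesis by (rule holds_with_prob_mono) (use gt_0 k in auto)
qed

lemma jacobian_estimate_outer:
  assumes k: "k < K" and t: "0 < t"
  shows "holds_with_prob P (1 - 2 * (real CARD('m) * real CARD('n)) * exp (- (real B * t\<^sup>2 / 2)))
    (\<lambda>\<omega>. spectral_norm (Jt k 0 \<omega> - g' (X k 0 \<omega>)) \<le> real CARD('m) * real CARD('n) * t * \<sigma>')"
proof -
  have "holds_with_prob P (1 - 2 * real DIM(real ^ 'n ^ 'm) * exp (- (real B * t\<^sup>2 / 2)))
    (\<lambda>\<omega>. norm (batch_mean B (\<lambda>j. gs' (\<xi>B k 0 j \<omega>) (X k 0 \<omega>)) - g' (X k 0 \<omega>))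
      \<le> real DIM(real ^ 'n ^ 'm) * t * \<sigma>')"
  proof (rule batch_mean_error[where c="\<lambda>_. \<sigma>'" and s=gs', OF D_prob D_borel _ past_events_vimage])
    show "fresh_batch P D (past_events P D (\<lambda>_. \<tau>) (per_iter A a) (per_iter B b) X \<xi>A \<xi>B k 0) B (\<xi>B k 0)"
      using batch_B[OF k, of 0] sizes by (simp add: per_iter_def[of B b 0])
    show "\<bar>(gs' \<xi> x - g' x) \<bullet> u\<bar> \<le> \<sigma>'" if "\<xi> \<in> supp D" "u \<in> Basis" for \<xi> x u
      using inner_Basis_le_spectral_norm[OF that(2)] dev_J[OF that(1)] order_trans by blast
  qed (use gs'_integrable gs'_mean cont_gs' cont_g' pos sizes t in auto)
  then show ?thesis
    by (rule holds_with_prob_mono) (use Jt_0 k in \<open>auto intro: order_trans[OF spectral_norm_le_norm]\<close>)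
qed

text \<open>The batch is fresh relative to both points of the pair, and the centred increments are
  bounded by \<open>l\<close> times their distance; that random distance scales the threshold and
  leaves the probability alone.\<close>

lemma value_estimate_inner:
  assumes k: "k < K" and i: "0 < i" "i < \<tau>" and t: "0 < t"
  shows "holds_with_prob P (1 - 2 * real CARD('m) * exp (- (real a * t\<^sup>2 / 2)))
    (\<lambda>\<omega>. norm ((gt k i \<omega> - gt k 0 \<omega>) - (g (X k i \<omega>) - g (X k 0 \<omega>)))
      \<le> real CARD('m) * t * (l * norm (X k i \<omega> - X k 0 \<omega>)))"
proof -
  have "holds_with_prob P (1 - 2 * real DIM(real ^ 'm) * exp (- (real a * t\<^sup>2 / 2)))
    (\<lambda>\<omega>. norm (batch_mean a (\<lambda>j. (\<lambda>\<xi> w. gs \<xi> (fst w) - gs \<xi> (snd w)) (\<xi>A k i j \<omega>) (X k i \<omega>, X k 0 \<omega>))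
        - (\<lambda>w. g (fst w) - g (snd w)) (X k i \<omega>, X k 0 \<omega>))
      \<le> real DIM(real ^ 'm) * t * (\<lambda>w. l * norm (fst w - snd w)) (X k i \<omega>, X k 0 \<omega>))"
  proof (rule batch_mean_error[OF D_prob D_borel _ past_events_vimage_pair])
    show "fresh_batch P D (past_events P D (\<lambda>_. \<tau>) (per_iter A a) (per_iter B b) X \<xi>A \<xi>B k i) a (\<xi>A k i)"
      using batch_A[OF k i(2)] i by (simp add: per_iter_def[of A a i])
    show "\<bar>((gs \<xi> (fst w) - gs \<xi> (snd w)) - (g (fst w) - g (snd w))) \<bullet> u\<bar> \<le> l * norm (fst w - snd w)"
      if "\<xi> \<in> supp D" "u \<in> Basis" for \<xi> w u
      using Basis_le_norm[OF that(2)] lip_g[OF that(1)] order_trans by blast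
    show "continuous_on UNIV (\<lambda>w. gs \<xi> (fst w) - gs \<xi> (snd w))" if "\<xi> \<in> supp D" for \<xi>
      by (intro continuous_intros continuous_on_compose2[OF cont_gs[OF that, of UNIV]]) auto
    show "continuous_on UNIV (\<lambda>w. g (fst w) - g (snd w))"
      by (intro continuous_intros continuous_on_compose2[OF cont_g[of UNIV]]) auto
    show "(\<lambda>w. l * norm (fst w - snd w)) \<in> borel_measurable borel"
      by (intro borel_measurable_continuous_onI continuous_intros)
  qed (use gs_integrable gs_mean pos sizes t in auto)
  then show ?thesis by (rule holds_with_prob_mono) (use gt_pos k i in auto)
qed

lemma jacobian_estimate_inner:
  assumes k: "k < K" and i: "0 < i" "i < \<tau>" and t: "0 < t"
  shows "holds_with_prob P (1 - 2 * (real CARD('m) * real CARD('n)) * exp (- (real b * t\<^sup>2 / 2)))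
    (\<lambda>\<omega>. spectral_norm ((Jt k i \<omega> - Jt k 0 \<omega>) - (g' (X k i \<omega>) - g' (X k 0 \<omega>)))
      \<le> real CARD('m) * real CARD('n) * t * (l' * norm (X k i \<omega> - X k 0 \<omega>)))"
proof -
  have "holds_with_prob P (1 - 2 * real DIM(real ^ 'n ^ 'm) * exp (- (real b * t\<^sup>2 / 2)))
    (\<lambda>\<omega>. norm (batch_mean b (\<lambda>j. (\<lambda>\<xi> w. gs' \<xi> (fst w) - gs' \<xi> (snd w)) (\<xi>B k i j \<omega>) (X k i \<omega>, X k 0 \<omega>))
        - (\<lambda>w. g' (fst w) - g' (snd w)) (X k i \<omega>, X k 0 \<omega>))
      \<le> real DIM(real ^ 'n ^ 'm) * t * (\<lambda>w. l' * norm (fst w - snd w)) (X k i \<omega>, X k 0 \<omega>))"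
  proof (rule batch_mean_error[OF D_prob D_borel _ past_events_vimage_pair])
    show "fresh_batch P D (past_events P D (\<lambda>_. \<tau>) (per_iter A a) (per_iter B b) X \<xi>A \<xi>B k i) b (\<xi>B k i)"
      using batch_B[OF k i(2)] i by (simp add: per_iter_def[of B b i])
    show "\<bar>((gs' \<xi> (fst w) - gs' \<xi> (snd w)) - (g' (fst w) - g' (snd w))) \<bullet> u\<bar> \<le> l' * norm (fst w - snd w)"
      if "\<xi> \<in> supp D" "u \<in> Basis" for \<xi> w u
      using inner_Basis_le_spectral_norm[OF that(2)] lip_J[OF that(1)] order_trans by blast
    show "continuous_on UNIV (\<lambda>w. gs' \<xi> (fst w) - gs' \<xi> (snd w))" if "\<xi> \<in> supp D" for \<xi>
      by (intro continuous_intros continuous_on_compose2[OF cont_gs'[OF that]]) auto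
    show "continuous_on UNIV (\<lambda>w. g' (fst w) - g' (snd w))"
      by (intro continuous_intros continuous_on_compose2[OF cont_g']) auto
    show "(\<lambda>w. l' * norm (fst w - snd w)) \<in> borel_measurable borel"
      by (intro borel_measurable_continuous_onI continuous_intros)
  qed (use gs'_integrable gs'_mean pos sizes t in auto)
  then show ?thesis
    by (rule holds_with_prob_mono) (use Jt_pos k i in \<open>auto intro: order_trans[OF spectral_norm_le_norm]\<close>)
qed

text \<open>Separates probability from optimisation: outside the failure events the pathwise
  \<open>trajectory_bound\<close> applies. The thresholds stay abstract, subject only to the tail
  conditions and to \<open>budget\<close>, which is the error condition of
  \<open>trajectory_bound\<close> with the drift \<open>d\<close> as a free variable.\<close>

lemma stationarity:
  assumes y0: "h y0 = ereal q0"
    and t: "0 < tA" "0 < tB" "0 < ta" "0 < tb"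
    and \<delta>: "2 * real CARD('m) * exp (- (real A * tA\<^sup>2 / 2)) \<le> \<delta>"
      "2 * real CARD('m) * exp (- (real a * ta\<^sup>2 / 2)) \<le> \<delta>"
      "2 * (real CARD('m) * real CARD('n)) * exp (- (real B * tB\<^sup>2 / 2)) \<le> \<delta>"
      "2 * (real CARD('m) * real CARD('n)) * exp (- (real b * tb\<^sup>2 / 2)) \<le> \<delta>"
    and budget: "\<And>d. 0 \<le> d \<Longrightarrow>
      2 * l_f * (real CARD('m) * tA * \<sigma> + real CARD('m) * ta * (l * d))
      + 8 * l_f\<^sup>2 / M * (real CARD('m) * real CARD('n) * tB * \<sigma>' + real CARD('m) * real CARD('n) * tb * (l' * d))\<^sup>2
      \<le> e + M / (5 * (real \<tau>)\<^sup>2) * d\<^sup>2"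
    and solver: "solver_assumption P f h M K (\<lambda>_. \<tau>) solver eps_bar delta_bar seed X gt Jt"
  shows "holds_with_prob P (1 - real K * real \<tau> * (2 * \<delta> + delta_bar))
    (\<lambda>\<omega>. (\<Sum>k<K. \<Sum>i<\<tau>. (norm (grad_map f g g' h M (X k i \<omega>)))\<^sup>2)
      \<le> 16 * M * (model_fin x_init y0 + q0 + M / 4 * (norm (y0 - x_init))\<^sup>2 - p
                 + real K * real \<tau> * (eps_bar + e)))"
proof -
  define G where "G = (\<lambda>k i \<omega>. if i = 0
      then norm (gt k 0 \<omega> - g (X k 0 \<omega>)) \<le> real CARD('m) * tA * \<sigma>
      else norm ((gt k i \<omega> - gt k 0 \<omega>) - (g (X k i \<omega>) - g (X k 0 \<omega>)))
        \<le> real CARD('m) * ta * (l * norm (X k i \<omega> - X k 0 \<omega>)))"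
  define J where "J = (\<lambda>k i \<omega>. if i = 0
      then spectral_norm (Jt k 0 \<omega> - g' (X k 0 \<omega>)) \<le> real CARD('m) * real CARD('n) * tB * \<sigma>'
      else spectral_norm ((Jt k i \<omega> - Jt k 0 \<omega>) - (g' (X k i \<omega>) - g' (X k 0 \<omega>)))
        \<le> real CARD('m) * real CARD('n) * tb * (l' * norm (X k i \<omega> - X k 0 \<omega>)))"
  define S where "S = (\<lambda>k i \<omega>. \<forall>z. prox_linear_model f h M (gt k i \<omega>) (Jt k i \<omega>) (X k i \<omega>) (X k (Suc i) \<omega>)
        \<le> prox_linear_model f h M (gt k i \<omega>) (Jt k i \<omega>) (X k i \<omega>) z + ereal eps_bar)"
  define I where "I = {..<K} \<times> {..<\<tau>}"
  \<comment> \<open>Value and Jacobian batches of one iteration are not assumed independent of each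
    other, so their failures and that of the solver are combined by a union bound.\<close>
  have "holds_with_prob P (1 - (\<delta> + (\<delta> + delta_bar)))
      (\<lambda>\<omega>. G (fst w) (snd w) \<omega> \<and> J (fst w) (snd w) \<omega> \<and> S (fst w) (snd w) \<omega>)" if "w \<in> I" for w
  proof -
    obtain k i where w: "w = (k, i)" and k: "k < K" and i: "i < \<tau>" using \<open>w \<in> I\<close> by (auto simp: I_def)
    have "holds_with_prob P (1 - \<delta>) (G k i)"
    proof (cases "i = 0")
      case True
      show ?thesis by (rule holds_with_prob_mono[OF value_estimate_outer[OF k t(1)]])
        (use \<delta>(1) True in \<open>auto simp: G_def\<close>)
    next
      case False
      show ?thesis by (rule holds_with_prob_mono[OF value_estimate_inner[OF k _ i t(3)]])
        (use \<delta>(2) False in \<open>auto simp: G_def\<close>)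
    qed
    moreover have "holds_with_prob P (1 - \<delta>) (J k i)"
    proof (cases "i = 0")
      case True
      show ?thesis by (rule holds_with_prob_mono[OF jacobian_estimate_outer[OF k t(2)]])
        (use \<delta>(3) True in \<open>auto simp: J_def\<close>)
    next
      case False
      show ?thesis by (rule holds_with_prob_mono[OF jacobian_estimate_inner[OF k _ i t(4)]])
        (use \<delta>(4) False in \<open>auto simp: J_def\<close>)
    qed
    moreover have "holds_with_prob P (1 - delta_bar) (S k i)"
    proof -
      have "holds_with_prob P (1 - delta_bar) (\<lambda>\<omega>.
        let s = prox_linear_model f h M (gt k i \<omega>) (Jt k i \<omega>) (X k i \<omega>)
        in s (solver s eps_bar delta_bar (seed k i \<omega>)) \<le> (INF y. s y) + ereal eps_bar)"
        using solver k i unfolding solver_assumption_def by blast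
      then show ?thesis
      proof (rule holds_with_prob_mono)
        fix \<omega> assume \<omega>: "\<omega> \<in> space P"
          and *: "let s = prox_linear_model f h M (gt k i \<omega>) (Jt k i \<omega>) (X k i \<omega>)
            in s (solver s eps_bar delta_bar (seed k i \<omega>)) \<le> (INF y. s y) + ereal eps_bar"
        show "S k i \<omega>" unfolding S_def
        proof
          fix z
          let ?s = "prox_linear_model f h M (gt k i \<omega>) (Jt k i \<omega>) (X k i \<omega>)"
          have "?s (X k (Suc i) \<omega>) \<le> (INF y. ?s y) + ereal eps_bar"
            using * X_inner[OF k i \<omega>] by (simp add: Let_def)
          also have "\<dots> \<le> ?s z + ereal eps_bar" by (intro add_right_mono INF_lower) simp
          finally show "?s (X k (Suc i) \<omega>) \<le> ?s z + ereal eps_bar" .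
        qed
      qed simp
    qed
    ultimately show ?thesis unfolding w fst_conv snd_conv by (intro holds_with_prob_conj) auto
  qed
  then have "holds_with_prob P (1 - (\<Sum>w\<in>I. \<delta> + (\<delta> + delta_bar)))
      (\<lambda>\<omega>. \<forall>w\<in>I. G (fst w) (snd w) \<omega> \<and> J (fst w) (snd w) \<omega> \<and> S (fst w) (snd w) \<omega>)"
    by (intro holds_with_prob_ball) (auto simp: I_def)
  then show ?thesis
  proof (rule holds_with_prob_mono)
    show "1 - real K * real \<tau> * (2 * \<delta> + delta_bar) \<le> 1 - (\<Sum>w\<in>I. \<delta> + (\<delta> + delta_bar))"
      by (simp add: I_def card_cartesian_product)
    fix \<omega> assume \<omega>: "\<omega> \<in> space P"
      and good: "\<forall>w\<in>I. G (fst w) (snd w) \<omega> \<and> J (fst w) (snd w) \<omega> \<and> S (fst w) (snd w) \<omega>"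
    have G: "G k i \<omega>" and J: "J k i \<omega>" and S: "S k i \<omega>" if "k < K" "i < \<tau>" for k i
      using bspec[OF good, of "(k, i)"] that by (auto simp: I_def)
    have "(\<Sum>k<K. \<Sum>i<\<tau>. (norm (grad_map f g g' h M (X k i \<omega>)))\<^sup>2)
      \<le> 16 * M * (model_fin (X 0 0 \<omega>) y0 + q0 + M / 4 * (norm (y0 - X 0 0 \<omega>))\<^sup>2 - p
                 + real K * real \<tau> * (eps_bar + e))"
    proof (rule trajectory_bound[where c="\<lambda>k i. gt k i \<omega>" and J="\<lambda>k i. Jt k i \<omega>", OF sizes(1,2) y0])
      show "X (Suc k) 0 \<omega> = X k \<tau> \<omega>" if "k < K" for k using X_outer[OF that \<omega>] .
      show "prox_linear_model f h M (gt k i \<omega>) (Jt k i \<omega>) (X k i \<omega>) (X k (Suc i) \<omega>)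
        \<le> prox_linear_model f h M (gt k i \<omega>) (Jt k i \<omega>) (X k i \<omega>) z + ereal eps_bar"
        if "k < K" "i < \<tau>" for k i z using S[OF that] by (simp add: S_def)
      fix k i assume k: "k < K" and i: "i < \<tau>"
      \<comment> \<open>For \<open>i = 0\<close> the drift is 0 and only the first error remains;
        for \<open>i > 0\<close> the triangle inequality adds the error of the correction to that of
        the loop's first estimate.\<close>
      define d where "d = norm (X k i \<omega> - X k 0 \<omega>)"
      have "norm (gt k i \<omega> - g (X k i \<omega>)) \<le> real CARD('m) * tA * \<sigma> + real CARD('m) * ta * (l * d)"
      proof (cases "i = 0")
        case True
        then show ?thesis using G[OF k i] by (simp add: G_def d_def)
      next
        case False
        have "gt k i \<omega> - g (X k i \<omega>)
            = (gt k 0 \<omega> - g (X k 0 \<omega>)) + ((gt k i \<omega> - gt k 0 \<omega>) - (g (X k i \<omega>) - g (X k 0 \<omega>)))"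
          by simp
        then show ?thesis
          using G[OF k i] G[OF k sizes(2)] False norm_triangle_ineq order_trans add_mono
          unfolding G_def d_def by (smt (verit))
      qed
      moreover have "spectral_norm (Jt k i \<omega> - g' (X k i \<omega>))
          \<le> real CARD('m) * real CARD('n) * tB * \<sigma>' + real CARD('m) * real CARD('n) * tb * (l' * d)"
      proof (cases "i = 0")
        case True
        then show ?thesis using J[OF k i] by (simp add: J_def d_def)
      next
        case False
        have "Jt k i \<omega> - g' (X k i \<omega>)
            = (Jt k 0 \<omega> - g' (X k 0 \<omega>)) + ((Jt k i \<omega> - Jt k 0 \<omega>) - (g' (X k i \<omega>) - g' (X k 0 \<omega>)))"
          by simp
        then show ?thesis
          using J[OF k i] J[OF k sizes(2)] False spectral_norm_triangle order_trans add_mono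
          unfolding J_def d_def by (smt (verit))
      qed
      ultimately have "2 * l_f * norm (gt k i \<omega> - g (X k i \<omega>))
          + 8 * l_f\<^sup>2 / M * (spectral_norm (Jt k i \<omega> - g' (X k i \<omega>)))\<^sup>2
        \<le> 2 * l_f * (real CARD('m) * tA * \<sigma> + real CARD('m) * ta * (l * d))
          + 8 * l_f\<^sup>2 / M * (real CARD('m) * real CARD('n) * tB * \<sigma>' + real CARD('m) * real CARD('n) * tb * (l' * d))\<^sup>2"
        using l_f_pos M_pos spectral_norm_nonneg by (intro add_mono mult_left_mono power_mono) auto
      also have "\<dots> \<le> e + M / (5 * (real \<tau>)\<^sup>2) * d\<^sup>2" by (rule budget) (simp add: d_def)
      finally show "2 * l_f * norm (gt k i \<omega> - g (X k i \<omega>))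
          + 8 * l_f\<^sup>2 / M * (spectral_norm (Jt k i \<omega> - g' (X k i \<omega>)))\<^sup>2
        \<le> e + M / (5 * (real \<tau>)\<^sup>2) * (norm (X k i \<omega> - X k 0 \<omega>))\<^sup>2" by (simp add: d_def)
    qed
    then show "(\<Sum>k<K. \<Sum>i<\<tau>. (norm (grad_map f g g' h M (X k i \<omega>)))\<^sup>2)
      \<le> 16 * M * (model_fin x_init y0 + q0 + M / 4 * (norm (y0 - x_init))\<^sup>2 - p
                 + real K * real \<tau> * (eps_bar + e))"
      using X_init[OF \<omega>] by simp
  qed
qed

end

section \<open>Batch sizes and oracle complexity\<close>

text \<open>The factor 4 exceeds e and the remaining factors are at least 1. The bound serves to
  absorb roundings and additive constants into the logarithm.\<close>

lemma batch_log_ge_1: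
  assumes "0 < K" "0 < \<tau>" "0 < \<Delta>" "\<Delta> < 1" "1 \<le> d"
  shows "1 \<le> ln (4 * real d * real K * real \<tau> / \<Delta>)"
proof -
  have "1 \<le> real d * real K" "1 \<le> real \<tau>" using assms by (auto simp: Suc_le_eq simp flip: of_nat_mult)
  then have "1 * 1 \<le> real d * real K * real \<tau>" by (intro mult_mono) auto
  then have "4 \<le> 4 * real d * real K * real \<tau>" by simp
  moreover have "\<dots> \<le> 4 * real d * real K * real \<tau> / \<Delta>"
    using assms by (simp add: le_divide_eq mult_left_le)
  ultimately have "exp 1 \<le> 4 * real d * real K * real \<tau> / \<Delta>" using exp_le by linarith
  then have "ln (exp 1) \<le> ln (4 * real d * real K * real \<tau> / \<Delta>)" by (intro ln_mono) auto
  then show ?thesis by simp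
qed

lemma batch_size_ge:
  "c * ln (4 * real d * real K * real \<tau> / \<Delta>) \<le> real (batch_size c d K \<tau> \<Delta>)"
  unfolding batch_size_def by linarith

text \<open>Rounding up costs at most 1, which is at most \<open>u\<close> times the logarithm; this
  accounts for \<open>C + 1\<close>.\<close>

lemma batch_size_le:
  assumes "0 < K" "0 < \<tau>" "0 < \<Delta>" "\<Delta> < 1" "1 \<le> d" "0 \<le> C" "1 \<le> u"
  shows "real (batch_size (C * u) d K \<tau> \<Delta>) \<le> (C + 1) * u * ln (4 * real d * real K * real \<tau> / \<Delta>)"
proof -
  define L where "L = ln (4 * real d * real K * real \<tau> / \<Delta>)"
  have L: "1 \<le> L" unfolding L_def using assms by (intro batch_log_ge_1) auto
  have "0 \<le> C * u * L" using assms L by simp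
  then have "real (nat \<lceil>C * u * L\<rceil>) \<le> C * u * L + 1" by linarith
  moreover have "1 * 1 \<le> u * L" using assms L by (intro mult_mono) auto
  ultimately show ?thesis unfolding batch_size_def L_def[symmetric] by (simp add: algebra_simps)
qed

lemma batch_size_pos:
  assumes "0 < K" "0 < \<tau>" "0 < \<Delta>" "\<Delta> < 1" "1 \<le> d" "0 < c"
  shows "0 < batch_size c d K \<tau> \<Delta>"
proof -
  have "0 < c * ln (4 * real d * real K * real \<tau> / \<Delta>)"
    using batch_log_ge_1[OF assms(1-5)] assms(6) by (intro mult_pos_pos) auto
  then have "0 < real (batch_size c d K \<tau> \<Delta>)" using batch_size_ge[of c d K \<tau> \<Delta>] by linarith
  then show ?thesis by simp
qed

text \<open>With \<open>c * t\<^sup>2 = 4\<close> the exponent is twice the logarithm, so the tail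
  is at most \<open>1 / x\<^sup>2\<close>. The \<open>d\<^sup>2\<close> in \<open>x\<^sup>2\<close>
  pays for the number \<open>r\<close> of coordinates, even the product of two dimensions, and one
  of the two factors \<open>\<Delta> / (K * \<tau>)\<close> is discarded.\<close>

lemma batch_size_tail:
  assumes pos: "0 < K" "0 < \<tau>" "0 < \<Delta>" "\<Delta> < 1" "1 \<le> d"
    and ct: "c * t\<^sup>2 = 4" and r: "0 \<le> r" "r \<le> 2 * (real d)\<^sup>2"
  shows "2 * r * exp (- (real (batch_size c d K \<tau> \<Delta>) * t\<^sup>2 / 2)) \<le> \<Delta> / (4 * real K * real \<tau>)"
proof -
  define x where "x = 4 * real d * real K * real \<tau> / \<Delta>"
  have x: "0 < x" using pos by (simp add: x_def)
  have "c * ln x * t\<^sup>2 / 2 \<le> real (batch_size c d K \<tau> \<Delta>) * t\<^sup>2 / 2"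
    using batch_size_ge[of c d K \<tau> \<Delta>] by (intro divide_right_mono mult_right_mono) (auto simp: x_def)
  moreover have "c * ln x * t\<^sup>2 / 2 = 2 * ln x" using ct by (simp add: mult_ac)
  ultimately have "exp (- (real (batch_size c d K \<tau> \<Delta>) * t\<^sup>2 / 2)) \<le> exp (- (2 * ln x))" by simp
  also have "\<dots> = 1 / x\<^sup>2"
    using x by (simp add: exp_minus inverse_eq_divide exp_double)
  finally have tail: "exp (- (real (batch_size c d K \<tau> \<Delta>) * t\<^sup>2 / 2)) \<le> 1 / x\<^sup>2" .
  have "2 * r * exp (- (real (batch_size c d K \<tau> \<Delta>) * t\<^sup>2 / 2)) \<le> 4 * (real d)\<^sup>2 * (1 / x\<^sup>2)"
    by (rule mult_mono[OF _ tail]) (use r in auto)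
  also have "\<dots> = (\<Delta> / (4 * real K * real \<tau>)) * (\<Delta> / (real K * real \<tau>))"
    using pos by (simp add: x_def power2_eq_square field_simps)
  also have "\<dots> \<le> (\<Delta> / (4 * real K * real \<tau>)) * 1"
  proof (intro mult_left_mono)
    have "1 * 1 \<le> real K * real \<tau>" using pos by (intro mult_mono) auto
    then show "\<Delta> / (real K * real \<tau>) \<le> 1" using pos by (simp add: divide_le_eq)
  qed (use pos in auto)
  finally show ?thesis by simp
qed

section \<open>Counting oracle calls\<close>

lemma outer_iters_pos: "0 < C \<Longrightarrow> 0 < \<epsilon> \<Longrightarrow> 0 < \<tau> \<Longrightarrow> 0 < outer_iters C \<epsilon> \<tau>"
  by (simp add: outer_iters_def)

lemma outer_iters_mult_ge:
  assumes "0 < \<tau>"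
  shows "C / \<epsilon> \<le> real (outer_iters C \<epsilon> \<tau>) * real \<tau>"
proof -
  have "C * (1 / \<epsilon>) / real \<tau> \<le> real (outer_iters C \<epsilon> \<tau>)" unfolding outer_iters_def by linarith
  then have "C * (1 / \<epsilon>) / real \<tau> * real \<tau> \<le> real (outer_iters C \<epsilon> \<tau>) * real \<tau>" by (intro mult_right_mono) auto
  then show ?thesis using assms by simp
qed

lemma oracle_calls_le:
  "real (oracle_calls K (\<lambda>_. \<tau>) N n) \<le> real K * real N + 2 * (real K * real \<tau>) * real n"
proof -
  have "(\<Sum>i<\<tau>. per_iter N (2 * n) i) \<le> N + 2 * \<tau> * n"
  proof (induction \<tau>)
    case (Suc \<tau>)
    then show ?case by (cases \<tau>) (auto simp: per_iter_def algebra_simps)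
  qed simp
  then have "oracle_calls K (\<lambda>_. \<tau>) N n \<le> (\<Sum>k<K. N + 2 * \<tau> * n)"
    unfolding oracle_calls_def by (intro sum_mono)
  then have "real (oracle_calls K (\<lambda>_. \<tau>) N n) \<le> real (\<Sum>k<K. N + 2 * \<tau> * n)" by (rule of_nat_mono)
  then show ?thesis by (simp add: algebra_simps)
qed

text \<open>\<open>q = 1\<close> is the count for values and \<open>q = 0\<close> the one for
  Jacobians. A single power of \<open>ln (1 / \<epsilon>)\<close> suffices, since every batch size
  carries just one logarithm.\<close>

lemma oracle_calls_at_most_soft_theta:
  fixes \<tau> :: "real \<Rightarrow> nat" and \<Delta> :: "real \<Rightarrow> real"
  assumes C: "0 < C" "0 < CN" "0 < Cn" and d: "1 \<le> d"
    and \<tau>: "\<And>\<epsilon>. 0 < \<tau> \<epsilon>" "(\<lambda>\<epsilon>. real (\<tau> \<epsilon>)) \<in> O[at_right 0](\<lambda>\<epsilon>. 1 / \<epsilon>)"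
    and \<Delta>: "\<Delta>0 < 1" "\<And>\<epsilon>. 0 < \<Delta> \<epsilon>" "\<And>\<epsilon>. \<Delta> \<epsilon> \<le> \<Delta>0"
  shows "at_most_soft_theta
    (\<lambda>\<epsilon>. let K = outer_iters C \<epsilon> (\<tau> \<epsilon>) in
       real (oracle_calls K (\<lambda>_. \<tau> \<epsilon>)
         (batch_size (CN * (1 / \<epsilon>) ^ Suc q) d K (\<tau> \<epsilon>) (\<Delta> \<epsilon>))
         (batch_size (Cn * ((real (\<tau> \<epsilon>))\<^sup>2 * (1 / \<epsilon>) ^ q)) d K (\<tau> \<epsilon>) (\<Delta> \<epsilon>))))
    (\<lambda>\<epsilon>. ((1 / \<epsilon>) ^ Suc (Suc q) * (1 / real (\<tau> \<epsilon>)) + (1 / \<epsilon>) ^ Suc q * (real (\<tau> \<epsilon>))\<^sup>2) * ln (1 / \<Delta> \<epsilon>))"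
proof -
  obtain ct where ct: "0 < ct" "eventually (\<lambda>\<epsilon>. norm (real (\<tau> \<epsilon>)) \<le> ct * norm (1 / \<epsilon>)) (at_right 0)"
    using landau_o.bigE[OF \<tau>(2)] by blast
  define k1 where "k1 = C + ct"
  define lam where "lam = ln (1 / \<Delta>0)"
  define k2 where "k2 = (\<bar>ln (4 * real d * k1)\<bar> + 1) / lam + 1"
  define k3 where "k3 = k1 * (CN + 1) + 2 * k1 * (Cn + 1)"
  have k1: "0 < k1" using C ct by (simp add: k1_def)
  have "0 < \<Delta>0" using \<Delta>(2,3)[of 0] by linarith
  then have lam: "0 < lam" using \<Delta>(1) by (simp add: lam_def ln_div)
  have k2: "0 < k2" using lam by (simp add: k2_def add_nonneg_pos)
  have k3: "0 < k3" using C k1 by (simp add: k3_def add_pos_pos)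
  define v where "v = (\<lambda>\<epsilon>. ((1 / \<epsilon>) ^ Suc (Suc q) * (1 / real (\<tau> \<epsilon>)) + (1 / \<epsilon>) ^ Suc q * (real (\<tau> \<epsilon>))\<^sup>2) * ln (1 / \<Delta> \<epsilon>))"
  define u where "u = (\<lambda>\<epsilon>. let K = outer_iters C \<epsilon> (\<tau> \<epsilon>) in
       real (oracle_calls K (\<lambda>_. \<tau> \<epsilon>)
         (batch_size (CN * (1 / \<epsilon>) ^ Suc q) d K (\<tau> \<epsilon>) (\<Delta> \<epsilon>))
         (batch_size (Cn * ((real (\<tau> \<epsilon>))\<^sup>2 * (1 / \<epsilon>) ^ q)) d K (\<tau> \<epsilon>) (\<Delta> \<epsilon>))))"
  have "eventually (\<lambda>\<epsilon>::real. 0 < \<epsilon>) (at_right 0)" by (rule eventually_at_right_less)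
  \<comment> \<open>Ensures \<open>ln (1 / \<epsilon>) \<ge> 1\<close>, used to turn sums of
    logarithms into products.\<close>
  moreover have "eventually (\<lambda>\<epsilon>::real. \<epsilon> < exp (- 1)) (at_right 0)"
    by (rule eventually_at_rightI[of 0 "exp (-1)"]) auto
  ultimately have "eventually (\<lambda>\<epsilon>. u \<epsilon> \<le> k3 * k2 * (v \<epsilon> * ln (1 / \<epsilon>) ^ 1)) (at_right 0)"
    using ct(2)
  proof eventually_elim
    fix \<epsilon> :: real
    assume \<epsilon>: "0 < \<epsilon>" "\<epsilon> < exp (- 1)" and t_le: "norm (real (\<tau> \<epsilon>)) \<le> ct * norm (1 / \<epsilon>)"
    define t where "t = real (\<tau> \<epsilon>)"
    define K where "K = outer_iters C \<epsilon> (\<tau> \<epsilon>)"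
    define N where "N = batch_size (CN * (1 / \<epsilon>) ^ Suc q) d K (\<tau> \<epsilon>) (\<Delta> \<epsilon>)"
    define n where "n = batch_size (Cn * (t\<^sup>2 * (1 / \<epsilon>) ^ q)) d K (\<tau> \<epsilon>) (\<Delta> \<epsilon>)"
    define L where "L = ln (4 * real d * real K * real (\<tau> \<epsilon>) / \<Delta> \<epsilon>)"
    define E where "E = ln (1 / \<epsilon>)"
    define W where "W = ln (1 / \<Delta> \<epsilon>)"
    have \<epsilon>1: "\<epsilon> < 1" using \<epsilon>(2) by (rule order_less_le_trans) simp
    have t: "1 \<le> t" using \<tau>(1)[of \<epsilon>] by (simp add: t_def Suc_leI)
    have tle: "t \<le> ct / \<epsilon>" using t_le \<epsilon> t by (simp add: t_def)
    have \<Delta>1: "0 < \<Delta> \<epsilon>" "\<Delta> \<epsilon> < 1" using \<Delta>(2,3)[of \<epsilon>] \<Delta>(1) by auto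
    have Kpos: "0 < K" unfolding K_def by (rule outer_iters_pos) (use C \<epsilon> \<tau> in auto)
    \<comment> \<open>The ceiling in \<open>K\<close> adds 1, and
      \<open>\<tau> = O(1 / \<epsilon>)\<close> is what makes this 1 at most
      \<open>ct / (\<epsilon> * t)\<close>, of the same order as the main term.\<close>
    have "0 \<le> C * (1 / \<epsilon>) / t" using C \<epsilon> t by simp
    then have "real K \<le> C * (1 / \<epsilon>) / t + 1" unfolding K_def outer_iters_def t_def[symmetric] by linarith
    moreover have "1 \<le> ct / (\<epsilon> * t)" using tle t \<epsilon> by (simp add: field_simps)
    moreover have "k1 / (\<epsilon> * t) = C * (1 / \<epsilon>) / t + ct / (\<epsilon> * t)" by (simp add: k1_def add_divide_distrib)
    ultimately have K: "real K \<le> k1 / (\<epsilon> * t)" by linarith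
    then have Kt: "real K * t \<le> k1 / \<epsilon>" using \<epsilon> t by (simp add: field_simps)
    have E: "1 \<le> E"
    proof -
      have "ln \<epsilon> < ln (exp (- 1))" using \<epsilon> by (subst ln_less_cancel_iff) auto
      then show ?thesis using \<epsilon> by (simp add: E_def ln_div)
    qed
    have W: "lam \<le> W" unfolding lam_def W_def
      using \<Delta>(2,3)[of \<epsilon>] \<open>0 < \<Delta>0\<close> by (simp add: ln_div)
    have L1: "1 \<le> L" unfolding L_def by (rule batch_log_ge_1) (use Kpos \<tau> \<Delta>1 d in auto)
    have LE: "L \<le> k2 * E * W"
    proof -
      have "4 * real d * real K * t / \<Delta> \<epsilon> \<le> 4 * real d * k1 * (1 / \<epsilon>) * (1 / \<Delta> \<epsilon>)"
      proof -
        have "4 * real d * (real K * t) * (1 / \<Delta> \<epsilon>) \<le> 4 * real d * (k1 / \<epsilon>) * (1 / \<Delta> \<epsilon>)"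
          using Kt \<Delta>1 by (intro mult_right_mono mult_left_mono) auto
        then show ?thesis by (simp add: mult.assoc)
      qed
      then have "L \<le> ln (4 * real d * k1 * (1 / \<epsilon>) * (1 / \<Delta> \<epsilon>))"
        unfolding L_def t_def[symmetric] using Kpos t \<Delta>1 d by (intro ln_mono) auto
      also have "\<dots> = ln (4 * real d * k1) + E + W"
        unfolding E_def W_def using d k1 \<epsilon> \<Delta>1 by (subst ln_mult ln_mult_pos, simp, simp)+ auto
      also have "\<dots> \<le> (\<bar>ln (4 * real d * k1)\<bar> + 1) * E + W"
      proof -
        have "\<bar>ln (4 * real d * k1)\<bar> * 1 \<le> \<bar>ln (4 * real d * k1)\<bar> * E" using E by (intro mult_left_mono) auto
        then show ?thesis by (simp add: distrib_right)
      qed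
      \<comment> \<open>From sum to product by \<open>W / lam \<ge> 1\<close> and
        \<open>E \<ge> 1\<close>. The former needs \<open>\<Delta>\<close> bounded away from
        1.\<close>
      also have "\<dots> \<le> (\<bar>ln (4 * real d * k1)\<bar> + 1) * E * (W / lam) + E * W"
      proof (rule add_mono)
        have "(\<bar>ln (4 * real d * k1)\<bar> + 1) * E * 1 \<le> (\<bar>ln (4 * real d * k1)\<bar> + 1) * E * (W / lam)"
          using E W lam by (intro mult_left_mono) auto
        then show "(\<bar>ln (4 * real d * k1)\<bar> + 1) * E \<le> (\<bar>ln (4 * real d * k1)\<bar> + 1) * E * (W / lam)" by simp
        have "1 * W \<le> E * W" using E W lam by (intro mult_right_mono) auto
        then show "W \<le> E * W" by simp
      qed
      also have "\<dots> = k2 * E * W" using lam by (simp add: k2_def field_simps)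
      finally show ?thesis .
    qed
    have eps_pow: "1 \<le> (1 / \<epsilon>) ^ j" for j using \<epsilon> \<epsilon>1 by (intro one_le_power) simp
    have N: "real N \<le> (CN + 1) * (1 / \<epsilon>) ^ Suc q * L" unfolding N_def L_def
      by (rule batch_size_le) (use Kpos \<tau> \<Delta>1 d C eps_pow[of "Suc q"] in auto)
    have n: "real n \<le> (Cn + 1) * (t\<^sup>2 * (1 / \<epsilon>) ^ q) * L" unfolding n_def L_def
    proof (rule batch_size_le)
      have "1 * 1 \<le> t\<^sup>2 * (1 / \<epsilon>) ^ q" using t eps_pow[of q] by (intro mult_mono) auto
      then show "1 \<le> t\<^sup>2 * (1 / \<epsilon>) ^ q" by simp
    qed (use Kpos \<tau> \<Delta>1 d C in auto)
    have "u \<epsilon> \<le> real K * real N + 2 * (real K * t) * real n"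
      unfolding u_def Let_def K_def[symmetric] t_def[symmetric] N_def[symmetric] n_def[symmetric]
      using oracle_calls_le[of K "\<tau> \<epsilon>" N n] by (simp add: t_def)
    also have "\<dots> \<le> k1 / (\<epsilon> * t) * ((CN + 1) * (1 / \<epsilon>) ^ Suc q * L)
        + 2 * (k1 / \<epsilon>) * ((Cn + 1) * (t\<^sup>2 * (1 / \<epsilon>) ^ q) * L)"
      using K Kt N n k1 \<epsilon> t by (intro add_mono mult_mono) auto
    also have "\<dots> = (k1 * (CN + 1) * ((1 / \<epsilon>) ^ Suc (Suc q) * (1 / t)) + 2 * k1 * (Cn + 1) * ((1 / \<epsilon>) ^ Suc q * t\<^sup>2)) * L"
      using \<epsilon> t by (simp add: field_simps power2_eq_square)
    also have "\<dots> \<le> (k3 * ((1 / \<epsilon>) ^ Suc (Suc q) * (1 / t) + (1 / \<epsilon>) ^ Suc q * t\<^sup>2)) * L"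
    proof (intro mult_right_mono)
      have k: "k1 * (CN + 1) \<le> k3" "2 * k1 * (Cn + 1) \<le> k3" using k1 C by (auto simp: k3_def)
      have "0 \<le> (1 / \<epsilon>) ^ Suc (Suc q) * (1 / t)" "0 \<le> (1 / \<epsilon>) ^ Suc q * t\<^sup>2" using \<epsilon> t by auto
      from k(1)[THEN mult_right_mono, OF this(1)] k(2)[THEN mult_right_mono, OF this(2)]
      have "k1 * (CN + 1) * ((1 / \<epsilon>) ^ Suc (Suc q) * (1 / t)) \<le> k3 * ((1 / \<epsilon>) ^ Suc (Suc q) * (1 / t))"
        "2 * k1 * (Cn + 1) * ((1 / \<epsilon>) ^ Suc q * t\<^sup>2) \<le> k3 * ((1 / \<epsilon>) ^ Suc q * t\<^sup>2)" .
      then show "k1 * (CN + 1) * ((1 / \<epsilon>) ^ Suc (Suc q) * (1 / t)) + 2 * k1 * (Cn + 1) * ((1 / \<epsilon>) ^ Suc q * t\<^sup>2)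
          \<le> k3 * ((1 / \<epsilon>) ^ Suc (Suc q) * (1 / t) + (1 / \<epsilon>) ^ Suc q * t\<^sup>2)"
        unfolding distrib_left by (rule add_mono)
    qed (use L1 in auto)
    also have "\<dots> \<le> (k3 * ((1 / \<epsilon>) ^ Suc (Suc q) * (1 / t) + (1 / \<epsilon>) ^ Suc q * t\<^sup>2)) * (k2 * E * W)"
      using LE k3 \<epsilon> t by (intro mult_left_mono) auto
    finally show "u \<epsilon> \<le> k3 * k2 * (v \<epsilon> * ln (1 / \<epsilon>) ^ 1)"
      unfolding v_def t_def[symmetric] E_def[symmetric] W_def[symmetric] by (simp only: power_one_right mult_ac)
  qed
  moreover have "(\<lambda>\<epsilon>. k3 * k2 * (v \<epsilon> * ln (1 / \<epsilon>) ^ 1)) \<in> \<Theta>[at_right 0](\<lambda>\<epsilon>. v \<epsilon> * ln (1 / \<epsilon>) ^ 1)"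
    by (subst landau_theta.cmult_in_iff) (use k2 k3 in auto)
  ultimately show ?thesis
    unfolding at_most_soft_theta_def soft_theta_def u_def[symmetric] v_def[symmetric]
    by (intro bexI[of _ "\<lambda>\<epsilon>. k3 * k2 * (v \<epsilon> * ln (1 / \<epsilon>) ^ 1)"] CollectI exI[of _ 1])
qed

section \<open>Choice of the constants\<close>

text \<open>To be used with \<open>s\<close> the square root of \<open>\<epsilon>\<close> and
  \<open>u\<close> the drift divided by \<open>\<tau>\<close>. The constants are chosen so that
  1/450 + 1/450 + 16/8100 stays below 1/150 for \<open>s\<^sup>2 / M\<close>, and 1/10 + 16/169
  below 1/5 for \<open>M * u\<^sup>2\<close>; 1/150 matches the solver tolerance.\<close>

lemma error_budget:
  fixes l_f M s u :: real
  assumes l_f: "0 < l_f" and M: "0 < M" and s: "0 \<le> s" and u: "0 \<le> u"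
    and \<gamma>: "0 \<le> \<gamma>" "l_f * \<gamma> \<le> 1 / (450 * M)" "l_f * \<gamma> \<le> M / 10"
  shows "2 * l_f * (s\<^sup>2 / (900 * M * l_f) + \<gamma> * s * u) + 8 * l_f\<^sup>2 / M * (s / (90 * l_f) + M / (13 * l_f) * u)\<^sup>2
    \<le> s\<^sup>2 / (150 * M) + M / 5 * u\<^sup>2"
proof -
  have "2 * l_f * (s\<^sup>2 / (900 * M * l_f)) = s\<^sup>2 / (450 * M)" using l_f M by (simp add: field_simps)
  moreover have "2 * l_f * (\<gamma> * s * u) \<le> s\<^sup>2 / (450 * M) + M / 10 * u\<^sup>2"
  proof -
    have "l_f * \<gamma> * (2 * s * u) \<le> l_f * \<gamma> * (s\<^sup>2 + u\<^sup>2)"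
      using sum_squares_bound[of s u] l_f \<gamma> by (intro mult_left_mono) auto
    also have "\<dots> = l_f * \<gamma> * s\<^sup>2 + l_f * \<gamma> * u\<^sup>2" by (simp add: distrib_left)
    also have "\<dots> \<le> 1 / (450 * M) * s\<^sup>2 + M / 10 * u\<^sup>2"
      using \<gamma> by (intro add_mono mult_right_mono) auto
    finally show ?thesis by (simp add: mult_ac)
  qed
  moreover have "8 * l_f\<^sup>2 / M * (s / (90 * l_f) + M / (13 * l_f) * u)\<^sup>2 \<le> 16 / 8100 * (s\<^sup>2 / M) + 16 / 169 * (M * u\<^sup>2)"
  proof -
    have "(s / (90 * l_f) + M / (13 * l_f) * u)\<^sup>2 \<le> 2 * (s / (90 * l_f))\<^sup>2 + 2 * (M / (13 * l_f) * u)\<^sup>2"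
      using sum_squares_bound[of "s / (90 * l_f)" "M / (13 * l_f) * u"] by (simp add: power2_sum)
    then have "8 * l_f\<^sup>2 / M * (s / (90 * l_f) + M / (13 * l_f) * u)\<^sup>2
        \<le> 8 * l_f\<^sup>2 / M * (2 * (s / (90 * l_f))\<^sup>2 + 2 * (M / (13 * l_f) * u)\<^sup>2)"
      using l_f M by (intro mult_left_mono) auto
    also have "\<dots> = 16 / 8100 * (s\<^sup>2 / M) + 16 / 169 * (M * u\<^sup>2)"
      using l_f M by (simp add: power2_eq_square field_simps)
    finally show ?thesis .
  qed
  moreover have "0 \<le> s\<^sup>2 / M" "0 \<le> M * u\<^sup>2" using M by auto
  moreover have "s\<^sup>2 / (450 * M) = 1 / 450 * (s\<^sup>2 / M)" "s\<^sup>2 / (150 * M) = 1 / 150 * (s\<^sup>2 / M)"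
    by simp_all
  ultimately show ?thesis unfolding distrib_left by linarith
qed

text \<open>All constants are fixed before \<open>\<epsilon>\<close>, \<open>\<Delta>\<close>,
  \<open>\<tau>\<close> and the probability space. Each batch constant is 4 times the squared ratio
  of a deviation range (with its dimension factor) to an admissible error, which is the condition
  \<open>c * t\<^sup>2 = 4\<close> of \<open>batch_size_tail\<close>.\<close>

lemma stationarity_constants:
  fixes f :: "real ^ 'm \<Rightarrow> real"
    and g :: "real ^ 'n \<Rightarrow> real ^ 'm"
    and g' :: "real ^ 'n \<Rightarrow> real ^ 'n ^ 'm"
    and h :: "real ^ 'n \<Rightarrow> ereal"
    and D :: "'s::second_countable_topology measure"
    and x_init :: "real ^ 'n"
  assumes problem: "composite_problem f g g' h l_f l_g L_g"
    and components: "stochastic_components g g' D gs gs'"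
    and V: "assumption_V g g' D gs gs' \<sigma>_g \<sigma>_g'"
    and UL: "assumption_UL D gs gs' lh_g Lh_g"
    and bounded_below: "(INF x. Phi f g h x) > -\<infinity>"
    and M: "M > 5 * l_f * L_g"
  obtains C_\<Sigma> C_A C_B C_a C_b :: real
  where "0 < C_\<Sigma>" "0 < C_A" "0 < C_B" "0 < C_a" "0 < C_b"
    "\<And>\<epsilon> \<Delta> \<tau> K (P :: 'w measure)
        (solver :: (real ^ 'n \<Rightarrow> ereal) \<Rightarrow> real \<Rightarrow> real \<Rightarrow> 'r \<Rightarrow> real ^ 'n) seed X gt Jt \<xi>A \<xi>B.
      0 < \<epsilon> \<Longrightarrow> 0 < \<Delta> \<Longrightarrow> \<Delta> < 1 \<Longrightarrow> 0 < \<tau> \<Longrightarrow> K = outer_iters C_\<Sigma> \<epsilon> \<tau> \<Longrightarrow>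
      algorithm_run P f h D gs gs' x_init M K (\<lambda>_. \<tau>)
        (batch_size (C_A * (1 / \<epsilon>)\<^sup>2) (CARD('m) + 1) K \<tau> \<Delta>)
        (batch_size (C_B * (1 / \<epsilon>)) (CARD('m) + CARD('n)) K \<tau> \<Delta>)
        (batch_size (C_a * (real \<tau>)\<^sup>2 * (1 / \<epsilon>)) (CARD('m) + 1) K \<tau> \<Delta>)
        (batch_size (C_b * (real \<tau>)\<^sup>2) (CARD('m) + CARD('n)) K \<tau> \<Delta>)
        solver (\<epsilon> / (5 * (30 * M))) (\<Delta> / (2 * real K * real \<tau>)) seed X gt Jt \<xi>A \<xi>B \<Longrightarrow>
      solver_assumption P f h M K (\<lambda>_. \<tau>) solver (\<epsilon> / (5 * (30 * M))) (\<Delta> / (2 * real K * real \<tau>)) seed X gt Jt \<Longrightarrow>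
      holds_with_prob P (1 - \<Delta>) (\<lambda>\<omega>.
        1 / (real K * real \<tau>) * (\<Sum>k<K. \<Sum>i<\<tau>. (norm (grad_map f g g' h M (X k i \<omega>)))\<^sup>2) \<le> \<epsilon>)"
proof -
  interpret composite_problem f g g' h l_f l_g L_g by (rule problem)
  interpret stochastic_components g g' D gs gs' by (rule components)
  have "\<exists>p. \<forall>y. ereal p \<le> Phi f g h y"
  proof (cases "INF x. Phi f g h x")
    case (real r)
    then show ?thesis by (metis INF_lower UNIV_I)
  next
    case PInf
    have "ereal 0 \<le> Phi f g h y" for y
      using INF_lower[of y UNIV "Phi f g h"] PInf by simp
    then show ?thesis by blast
  qed (use bounded_below in simp)
  then obtain p where p: "\<And>y. ereal p \<le> Phi f g h y" by blast
  interpret prox_linear f g g' h l_f l_g L_g M p by unfold_locales (use M p in auto)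
  obtain y0 q0 where y0: "h y0 = ereal q0"
    using h_closed_convex_proper unfolding closed_convex_proper_def by (metis ereal_cases)
  define V0 where "V0 = model_fin x_init y0 + q0 + M / 4 * (norm (y0 - x_init))\<^sup>2 - p"
  define m q where "m = real CARD('m)" and "q = real CARD('m) * real CARD('n)"
  \<comment> \<open>Absolute values and \<open>+ 1\<close> force positivity. \<open>l\<close> and
    \<open>l'\<close> add the Lipschitz constants of the means to those of the components, because
    the increments are centred.\<close>
  define \<sigma> \<sigma>' l l' where "\<sigma> = \<bar>\<sigma>_g\<bar> + 1" and "\<sigma>' = \<bar>\<sigma>_g'\<bar> + 1"
    and "l = \<bar>lh_g\<bar> + \<bar>l_g\<bar> + 1" and "l' = \<bar>Lh_g\<bar> + L_g + 1"
  have cpos: "0 < \<sigma>" "0 < \<sigma>'" "0 < l" "0 < l'" "0 < m" "0 < q"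
    using L_g_pos by (auto simp: \<sigma>_def \<sigma>'_def l_def l'_def m_def q_def)
  \<comment> \<open>The largest value that \<open>error_budget\<close> admits.\<close>
  define \<gamma> where "\<gamma> = min (1 / (450 * M)) (M / 10) / l_f"
  have \<gamma>: "0 < \<gamma>" "l_f * \<gamma> \<le> 1 / (450 * M)" "l_f * \<gamma> \<le> M / 10"
    using M_pos l_f_pos by (auto simp: \<gamma>_def)
  define \<alpha> \<beta> \<eta> where "\<alpha> = 1 / (900 * M * l_f)" and "\<beta> = 1 / (90 * l_f)" and "\<eta> = M / (13 * l_f)"
  have gr: "0 < \<alpha>" "0 < \<beta>" "0 < \<eta>" using M_pos l_f_pos by (auto simp: \<alpha>_def \<beta>_def \<eta>_def)
  \<comment> \<open>Makes \<open>16 * M * V0\<close> at most half of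
    \<open>\<epsilon> * (K * \<tau>)\<close>.\<close>
  define C_\<Sigma> where "C_\<Sigma> = 32 * M * \<bar>V0\<bar> + 1"
  define C_A where "C_A = 4 * (m * \<sigma> / \<alpha>)\<^sup>2"
  define C_B where "C_B = 4 * (q * \<sigma>' / \<beta>)\<^sup>2"
  define C_a where "C_a = 4 * (m * l / \<gamma>)\<^sup>2"
  define C_b where "C_b = 4 * (q * l' / \<eta>)\<^sup>2"
  have C: "0 < C_\<Sigma>" "0 < C_A" "0 < C_B" "0 < C_a" "0 < C_b"
    using cpos gr \<gamma>(1) M_pos by (auto simp: C_\<Sigma>_def C_A_def C_B_def C_a_def C_b_def add_nonneg_pos)
  show ?thesis
  proof (rule that[OF C])
    fix \<epsilon> \<Delta> :: real and \<tau> K :: nat and P :: "'w measure"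
      and solver :: "(real ^ 'n \<Rightarrow> ereal) \<Rightarrow> real \<Rightarrow> real \<Rightarrow> 'r \<Rightarrow> real ^ 'n"
      and seed X gt Jt \<xi>A \<xi>B
    let ?A = "batch_size (C_A * (1 / \<epsilon>)\<^sup>2) (CARD('m) + 1) K \<tau> \<Delta>"
    let ?B = "batch_size (C_B * (1 / \<epsilon>)) (CARD('m) + CARD('n)) K \<tau> \<Delta>"
    let ?a = "batch_size (C_a * (real \<tau>)\<^sup>2 * (1 / \<epsilon>)) (CARD('m) + 1) K \<tau> \<Delta>"
    let ?b = "batch_size (C_b * (real \<tau>)\<^sup>2) (CARD('m) + CARD('n)) K \<tau> \<Delta>"
    let ?eb = "\<epsilon> / (5 * (30 * M))" and ?db = "\<Delta> / (2 * real K * real \<tau>)"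
    assume \<epsilon>: "0 < \<epsilon>" and \<Delta>: "0 < \<Delta>" "\<Delta> < 1" and \<tau>: "0 < \<tau>" and K_def: "K = outer_iters C_\<Sigma> \<epsilon> \<tau>"
      and run: "algorithm_run P f h D gs gs' x_init M K (\<lambda>_. \<tau>) ?A ?B ?a ?b solver ?eb ?db seed X gt Jt \<xi>A \<xi>B"
      and sol: "solver_assumption P f h M K (\<lambda>_. \<tau>) solver ?eb ?db seed X gt Jt"
    have K: "0 < K" unfolding K_def using C \<epsilon> \<tau> by (intro outer_iters_pos)
    interpret algorithm_run P f h D gs gs' x_init M K "\<lambda>_. \<tau>" ?A ?B ?a ?b solver ?eb ?db seed X gt Jt \<xi>A \<xi>B
      by (rule run)
    interpret composite_run f g g' h l_f l_g L_g M p D gs gs' P x_init K \<tau> ?A ?B ?a ?b solver ?eb ?db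
      seed X gt Jt \<xi>A \<xi>B \<sigma> \<sigma>' l l'
    proof unfold_locales
      fix \<xi> assume \<xi>: "\<xi> \<in> supp D"
      show "norm (gs \<xi> x - g x) \<le> \<sigma>" for x
        using V \<xi> unfolding assumption_V_def \<sigma>_def by (smt (verit))
      show "spectral_norm (gs' \<xi> x - g' x) \<le> \<sigma>'" for x
        using V \<xi> unfolding assumption_V_def \<sigma>'_def by (smt (verit))
      show "norm ((gs \<xi> x - gs \<xi> y) - (g x - g y)) \<le> l * norm (x - y)" for x y
      proof -
        have "norm (gs \<xi> x - gs \<xi> y) \<le> lh_g * norm (x - y)" using UL \<xi> unfolding assumption_UL_def by blast
        moreover have "norm (g x - g y) \<le> l_g * norm (x - y)"
          using lipschitz_onD[OF g_lipschitz, of x y] by (simp add: dist_norm)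
        moreover have "(lh_g + l_g) * norm (x - y) \<le> l * norm (x - y)"
          by (intro mult_right_mono) (auto simp: l_def)
        ultimately show ?thesis
          using norm_triangle_ineq4[of "gs \<xi> x - gs \<xi> y" "g x - g y"] by (simp add: distrib_right)
      qed
      have UL': "spectral_norm (gs' \<xi> x - gs' \<xi> y) \<le> Lh_g * norm (x - y)" for x y
        using UL \<xi> unfolding assumption_UL_def by blast
      show "spectral_norm ((gs' \<xi> x - gs' \<xi> y) - (g' x - g' y)) \<le> l' * norm (x - y)" for x y
      proof -
        have "(gs' \<xi> x - gs' \<xi> y) - (g' x - g' y) = (gs' \<xi> x - gs' \<xi> y) + (g' y - g' x)" by simp
        then have "spectral_norm ((gs' \<xi> x - gs' \<xi> y) - (g' x - g' y))
            \<le> spectral_norm (gs' \<xi> x - gs' \<xi> y) + spectral_norm (g' y - g' x)"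
          using spectral_norm_triangle by metis
        also have "\<dots> \<le> Lh_g * norm (x - y) + L_g * norm (x - y)"
          using UL'[of x y] g'_lipschitz[of y x] by (simp add: norm_minus_commute)
        also have "\<dots> = (Lh_g + L_g) * norm (x - y)" by (simp add: distrib_right)
        also have "\<dots> \<le> l' * norm (x - y)" by (intro mult_right_mono) (auto simp: l'_def)
        finally show ?thesis .
      qed
      show "continuous_on UNIV (gs' \<xi>)" using UL' by (rule continuous_on_of_spectral_lipschitz)
    qed (use cpos K \<tau> \<Delta> \<epsilon> C in \<open>auto intro!: batch_size_pos simp: Suc_le_eq\<close>)
    define s where "s = sqrt \<epsilon>"
    have s: "0 < s" "s\<^sup>2 = \<epsilon>" using \<epsilon> by (simp_all add: s_def)
    define tA tB ta tb where "tA = \<alpha> * \<epsilon> / (m * \<sigma>)" and "tB = \<beta> * s / (q * \<sigma>')"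
      and "ta = \<gamma> * s / (real \<tau> * (m * l))" and "tb = \<eta> / (real \<tau> * (q * l'))"
    have t: "0 < tA" "0 < tB" "0 < ta" "0 < tb"
      using cpos gr \<gamma>(1) s \<epsilon> \<tau> by (auto simp: tA_def tB_def ta_def tb_def)
    have ct: "C_A * (1 / \<epsilon>)\<^sup>2 * tA\<^sup>2 = 4" "C_B * (1 / \<epsilon>) * tB\<^sup>2 = 4"
      "C_a * (real \<tau>)\<^sup>2 * (1 / \<epsilon>) * ta\<^sup>2 = 4" "C_b * (real \<tau>)\<^sup>2 * tb\<^sup>2 = 4"
      using cpos gr \<gamma>(1) s \<epsilon> \<tau>
      by (auto simp: C_A_def C_B_def C_a_def C_b_def tA_def tB_def ta_def tb_def power_mult_distrib power_divide)
    have m_le: "m \<le> 2 * (real (CARD('m) + 1))\<^sup>2"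
    proof -
      have "CARD('m) \<le> 2 * (CARD('m) + 1)\<^sup>2" by (simp add: power2_eq_square)
      then have "real CARD('m) \<le> real (2 * (CARD('m) + 1)\<^sup>2)" by (rule of_nat_mono)
      then show ?thesis by (simp add: m_def)
    qed
    have q_le: "q \<le> 2 * (real (CARD('m) + CARD('n)))\<^sup>2"
    proof -
      have "CARD('m) * CARD('n) \<le> 2 * (CARD('m) + CARD('n))\<^sup>2" by (simp add: power2_eq_square algebra_simps)
      then have "real (CARD('m) * CARD('n)) \<le> real (2 * (CARD('m) + CARD('n))\<^sup>2)" by (rule of_nat_mono)
      then show ?thesis by (simp add: q_def)
    qed
    define \<delta> where "\<delta> = \<Delta> / (4 * real K * real \<tau>)"
    have "holds_with_prob P (1 - real K * real \<tau> * (2 * \<delta> + ?db))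
      (\<lambda>\<omega>. (\<Sum>k<K. \<Sum>i<\<tau>. (norm (grad_map f g g' h M (X k i \<omega>)))\<^sup>2)
        \<le> 16 * M * (V0 + real K * real \<tau> * (?eb + \<epsilon> / (150 * M))))"
      unfolding V0_def
    proof (rule stationarity[OF y0 t _ _ _ _ _ sol])
      show "2 * real CARD('m) * exp (- (real ?A * tA\<^sup>2 / 2)) \<le> \<delta>"
        "2 * real CARD('m) * exp (- (real ?a * ta\<^sup>2 / 2)) \<le> \<delta>"
        unfolding \<delta>_def using m_le ct cpos by (auto intro!: batch_size_tail K \<tau> \<Delta> simp: m_def)
      show "2 * (real CARD('m) * real CARD('n)) * exp (- (real ?B * tB\<^sup>2 / 2)) \<le> \<delta>"
        "2 * (real CARD('m) * real CARD('n)) * exp (- (real ?b * tb\<^sup>2 / 2)) \<le> \<delta>"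
        unfolding \<delta>_def using q_le ct cpos by (auto intro!: batch_size_tail K \<tau> \<Delta> simp: q_def Suc_le_eq)
      fix d :: real assume d: "0 \<le> d"
      have "m * tA * \<sigma> = s\<^sup>2 / (900 * M * l_f)" "m * ta * (l * d) = \<gamma> * s * (d / real \<tau>)"
        "q * tB * \<sigma>' = s / (90 * l_f)" "q * tb * (l' * d) = M / (13 * l_f) * (d / real \<tau>)"
        using cpos \<tau> s by (simp_all add: tA_def ta_def tB_def tb_def \<alpha>_def \<beta>_def \<eta>_def)
      then have "2 * l_f * (m * tA * \<sigma> + m * ta * (l * d)) + 8 * l_f\<^sup>2 / M * (q * tB * \<sigma>' + q * tb * (l' * d))\<^sup>2
        \<le> s\<^sup>2 / (150 * M) + M / 5 * (d / real \<tau>)\<^sup>2"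
        using error_budget[of l_f M s "d / real \<tau>" \<gamma>] l_f_pos M_pos s d \<gamma> by simp
      also have "\<dots> = \<epsilon> / (150 * M) + M / (5 * (real \<tau>)\<^sup>2) * d\<^sup>2"
        by (simp add: s(2) power_divide)
      finally show "2 * l_f * (real CARD('m) * tA * \<sigma> + real CARD('m) * ta * (l * d))
        + 8 * l_f\<^sup>2 / M * (real CARD('m) * real CARD('n) * tB * \<sigma>' + real CARD('m) * real CARD('n) * tb * (l' * d))\<^sup>2
        \<le> \<epsilon> / (150 * M) + M / (5 * (real \<tau>)\<^sup>2) * d\<^sup>2"
        by (simp only: m_def q_def)
    qed
    then show "holds_with_prob P (1 - \<Delta>) (\<lambda>\<omega>.
        1 / (real K * real \<tau>) * (\<Sum>k<K. \<Sum>i<\<tau>. (norm (grad_map f g g' h M (X k i \<omega>)))\<^sup>2) \<le> \<epsilon>)"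
    proof (rule holds_with_prob_mono)
      \<comment> \<open>\<open>2 * \<delta>\<close> and \<open>?db\<close> both equal
        \<open>\<Delta> / (2 * K * \<tau>)\<close>, so the failures add up to exactly
        \<open>\<Delta>\<close>.\<close>
      show "1 - \<Delta> \<le> 1 - real K * real \<tau> * (2 * \<delta> + ?db)"
        using K \<tau> by (simp add: \<delta>_def field_simps)
      fix \<omega>
      let ?S = "\<Sum>k<K. \<Sum>i<\<tau>. (norm (grad_map f g g' h M (X k i \<omega>)))\<^sup>2"
      assume S: "?S \<le> 16 * M * (V0 + real K * real \<tau> * (?eb + \<epsilon> / (150 * M)))"
      define T where "T = real K * real \<tau>"
      have T: "0 < T" using K \<tau> by (simp add: T_def)
      have "C_\<Sigma> / \<epsilon> \<le> T" unfolding T_def K_def by (rule outer_iters_mult_ge) (rule \<tau>)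
      then have "C_\<Sigma> \<le> \<epsilon> * T" using \<epsilon> by (simp add: divide_le_eq mult.commute)
      moreover have "M * V0 \<le> M * \<bar>V0\<bar>" using M_pos by (intro mult_left_mono) auto
      ultimately have "32 * (M * V0) \<le> \<epsilon> * T" by (simp add: C_\<Sigma>_def)
      \<comment> \<open>The initial gap costs at most 1/2 of \<open>\<epsilon> * T\<close>, solver
        tolerance and estimator errors together 32/150, and the sum is below 1.\<close>
      moreover have "16 * M * (V0 + T * (?eb + \<epsilon> / (150 * M))) = 16 * (M * V0) + 32 / 150 * (\<epsilon> * T)"
        using M_pos by (simp add: field_simps)
      moreover have "0 \<le> \<epsilon> * T" using \<epsilon> T by simp
      ultimately have "?S \<le> \<epsilon> * T" using S unfolding T_def[symmetric] by linarith
      then show "1 / (real K * real \<tau>) * ?S \<le> \<epsilon>"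
        using T unfolding T_def[symmetric] by (simp add: divide_le_eq)
    qed
  qed
qed

theorem corollary3p7:
  fixes f :: "real ^ 'm \<Rightarrow> real"
    and g :: "real ^ 'n \<Rightarrow> real ^ 'm"
    and g' :: "real ^ 'n \<Rightarrow> real ^ 'n ^ 'm"
    and h :: "real ^ 'n \<Rightarrow> ereal"
    and l_f l_g L_g M :: real
    and D :: "'s::second_countable_topology measure"
    and gs :: "'s \<Rightarrow> real ^ 'n \<Rightarrow> real ^ 'm"
    and gs' :: "'s \<Rightarrow> real ^ 'n \<Rightarrow> real ^ 'n ^ 'm"
    and \<sigma>_g \<sigma>_g' lh_g Lh_g :: real
    and x_init :: "real ^ 'n"
  assumes "composite_problem f g g' h l_f l_g L_g"
    and "stochastic_components g g' D gs gs'"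
    and "assumption_V g g' D gs gs' \<sigma>_g \<sigma>_g'"
    and "assumption_UL D gs gs' lh_g Lh_g"
    and "(INF x. Phi f g h x) > -\<infinity>"
    and "M > 5 * l_f * L_g"
  shows "\<exists>C_\<Sigma>>0. \<exists>C_A>0. \<exists>C_B>0. \<exists>C_a>0. \<exists>C_b>0.
    (\<exists>\<epsilon>0>0. \<forall>\<epsilon> \<Delta> :: real. \<forall>\<tau>::nat. 0 < \<epsilon> \<and> \<epsilon> < \<epsilon>0 \<and> 0 < \<Delta> \<and> \<Delta> < 1 \<and> 0 < \<tau> \<longrightarrow>
      (let K = outer_iters C_\<Sigma> \<epsilon> \<tau>;
           A = batch_size (C_A * (1 / \<epsilon>)\<^sup>2) (CARD('m) + 1) K \<tau> \<Delta>;
           B = batch_size (C_B * (1 / \<epsilon>)) (CARD('m) + CARD('n)) K \<tau> \<Delta>;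
           a = batch_size (C_a * (real \<tau>)\<^sup>2 * (1 / \<epsilon>)) (CARD('m) + 1) K \<tau> \<Delta>;
           b = batch_size (C_b * (real \<tau>)\<^sup>2) (CARD('m) + CARD('n)) K \<tau> \<Delta>;
           delta_bar = \<Delta> / (2 * real K * real \<tau>);
           eps_bar = \<epsilon> / (5 * (30 * M))
       in \<forall>(P :: 'w measure)
            (solver :: (real ^ 'n \<Rightarrow> ereal) \<Rightarrow> real \<Rightarrow> real \<Rightarrow> 'r \<Rightarrow> real ^ 'n) seed X gt Jt \<xi>A \<xi>B.
            algorithm_run P f h D gs gs' x_init M K (\<lambda>_. \<tau>) A B a b
              solver eps_bar delta_bar seed X gt Jt \<xi>A \<xi>B \<and>
            solver_assumption P f h M K (\<lambda>_. \<tau>) solver eps_bar delta_bar seed X gt Jt \<longrightarrow>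
            holds_with_prob P (1 - \<Delta>) (\<lambda>\<omega>.
              1 / (real K * real \<tau>) *
                (\<Sum>k<K. \<Sum>i<\<tau>. (norm (grad_map f g g' h M (X k i \<omega>)))\<^sup>2) \<le> \<epsilon>))) \<and>
    (\<forall>(\<tau> :: real \<Rightarrow> nat) (\<Delta> :: real \<Rightarrow> real) \<Delta>0.
      (\<forall>\<epsilon>. 0 < \<tau> \<epsilon>) \<and> (\<lambda>\<epsilon>. real (\<tau> \<epsilon>)) \<in> O[at_right 0](\<lambda>\<epsilon>. 1 / \<epsilon>) \<and>
      \<Delta>0 < 1 \<and> (\<forall>\<epsilon>. 0 < \<Delta> \<epsilon> \<and> \<Delta> \<epsilon> \<le> \<Delta>0) \<longrightarrow>
      at_most_soft_theta
        (\<lambda>\<epsilon>. let K = outer_iters C_\<Sigma> \<epsilon> (\<tau> \<epsilon>) in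
           real (oracle_calls K (\<lambda>_. \<tau> \<epsilon>)
             (batch_size (C_A * (1 / \<epsilon>)\<^sup>2) (CARD('m) + 1) K (\<tau> \<epsilon>) (\<Delta> \<epsilon>))
             (batch_size (C_a * (real (\<tau> \<epsilon>))\<^sup>2 * (1 / \<epsilon>)) (CARD('m) + 1) K (\<tau> \<epsilon>) (\<Delta> \<epsilon>))))
        (\<lambda>\<epsilon>. ((1 / \<epsilon>) ^ 3 * (1 / real (\<tau> \<epsilon>)) + (1 / \<epsilon>)\<^sup>2 * (real (\<tau> \<epsilon>))\<^sup>2) * ln (1 / \<Delta> \<epsilon>)) \<and>
      at_most_soft_theta
        (\<lambda>\<epsilon>. let K = outer_iters C_\<Sigma> \<epsilon> (\<tau> \<epsilon>) in
           real (oracle_calls K (\<lambda>_. \<tau> \<epsilon>)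
             (batch_size (C_B * (1 / \<epsilon>)) (CARD('m) + CARD('n)) K (\<tau> \<epsilon>) (\<Delta> \<epsilon>))
             (batch_size (C_b * (real (\<tau> \<epsilon>))\<^sup>2) (CARD('m) + CARD('n)) K (\<tau> \<epsilon>) (\<Delta> \<epsilon>))))
        (\<lambda>\<epsilon>. ((1 / \<epsilon>)\<^sup>2 * (1 / real (\<tau> \<epsilon>)) + (1 / \<epsilon>) * (real (\<tau> \<epsilon>))\<^sup>2) * ln (1 / \<Delta> \<epsilon>)))"
proof -
  obtain C_\<Sigma> C_A C_B C_a C_b :: real
    where C: "0 < C_\<Sigma>" "0 < C_A" "0 < C_B" "0 < C_a" "0 < C_b"
    and bound: "\<And>\<epsilon> \<Delta> \<tau> K (P :: 'w measure)
        (solver :: (real ^ 'n \<Rightarrow> ereal) \<Rightarrow> real \<Rightarrow> real \<Rightarrow> 'r \<Rightarrow> real ^ 'n) seed X gt Jt \<xi>A \<xi>B.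
      0 < \<epsilon> \<Longrightarrow> 0 < \<Delta> \<Longrightarrow> \<Delta> < 1 \<Longrightarrow> 0 < \<tau> \<Longrightarrow> K = outer_iters C_\<Sigma> \<epsilon> \<tau> \<Longrightarrow>
      algorithm_run P f h D gs gs' x_init M K (\<lambda>_. \<tau>)
        (batch_size (C_A * (1 / \<epsilon>)\<^sup>2) (CARD('m) + 1) K \<tau> \<Delta>)
        (batch_size (C_B * (1 / \<epsilon>)) (CARD('m) + CARD('n)) K \<tau> \<Delta>)
        (batch_size (C_a * (real \<tau>)\<^sup>2 * (1 / \<epsilon>)) (CARD('m) + 1) K \<tau> \<Delta>)
        (batch_size (C_b * (real \<tau>)\<^sup>2) (CARD('m) + CARD('n)) K \<tau> \<Delta>)
        solver (\<epsilon> / (5 * (30 * M))) (\<Delta> / (2 * real K * real \<tau>)) seed X gt Jt \<xi>A \<xi>B \<Longrightarrow>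
      solver_assumption P f h M K (\<lambda>_. \<tau>) solver (\<epsilon> / (5 * (30 * M))) (\<Delta> / (2 * real K * real \<tau>)) seed X gt Jt \<Longrightarrow>
      holds_with_prob P (1 - \<Delta>) (\<lambda>\<omega>.
        1 / (real K * real \<tau>) * (\<Sum>k<K. \<Sum>i<\<tau>. (norm (grad_map f g g' h M (X k i \<omega>)))\<^sup>2) \<le> \<epsilon>)"
    by (rule stationarity_constants[OF assms]) blast
  show ?thesis
  proof (rule exI[of _ C_\<Sigma>], rule conjI[OF C(1)], rule exI[of _ C_A], rule conjI[OF C(2)],
      rule exI[of _ C_B], rule conjI[OF C(3)], rule exI[of _ C_a], rule conjI[OF C(4)],
      rule exI[of _ C_b], rule conjI[OF C(5)], intro conjI exI[of _ "1::real"] allI impI zero_less_one, goal_cases)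
    case (1 \<epsilon> \<Delta> \<tau>)
    then show ?case unfolding Let_def by (intro allI impI bound) auto
  next
    case (2 \<tau> \<Delta> \<Delta>0)
    then show ?case
      using oracle_calls_at_most_soft_theta[OF C(1,2,4), of "CARD('m) + 1" \<tau> \<Delta>0 \<Delta> 1]
      by (simp add: power2_eq_square power3_eq_cube mult.assoc)
  next
    case (3 \<tau> \<Delta> \<Delta>0)
    then show ?case
      using oracle_calls_at_most_soft_theta[OF C(1,3,5), of "CARD('m) + CARD('n)" \<tau> \<Delta>0 \<Delta> 0]
      by (simp add: power2_eq_square mult.assoc Suc_le_eq)
  qed
qed

end
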